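(* Let $q$ be a complex number with $|q|<1$. Then the following four identities hold: \begin{align*} \sum_{i,j,k\ge 0}\frac{q^{i^2+2j^2+4k^2+2ik+4jk}}{(q^2;q^2)_i(q^2;q^2)_j(q^4;q^4)_k} &= \frac{(q^5,q^6,q^{11};q^{11})_\infty}{(q;q^2)_\infty(q^4;q^4)_\infty},\\ \sum_{i,j,k\ge 0}\frac{q^{i^2+2j^2+4k^2+2ik+4jk+2k}}{(q^2;q^2)_i(q^2;q^2)_j(q^4;q^4)_k} &= \frac{(q^4,q^7,q^{11};q^{11})_\infty}{(q;q^2)_\infty(q^4;q^4)_\infty},\\ \sum_{i,j,k\ge 0}\frac{q^{i^2+2j^2+4k^2+2ik+4jk+2j+4k}}{(q^2;q^2)_i(q^2;q^2)_j(q^4;q^4)_k} &= \frac{(q^2,q^9,q^{11};q^{11})_\infty}{(q;q^2)_\infty(q^4;q^4)_\infty},\\ \sum_{i,j,k\ge 0}\frac{q^{i^2+2j^2+4k^2+2ik+4jk+2i+2j+4k}}{(q^2;q^2)_i(q^2;q^2)_j(q^4;q^4)_k} &= \frac{(q,q^{10},q^{11};q^{11})_\infty}{(q;q^2)_\infty(q^4;q^4)_\infty}. \end{align*}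
   Context: For $|q|<1$: $(a;q)_\infty=\prod_{m=0}^\infty(1-aq^m)$, $(a;q)_n=(a;q)_\infty/(aq^n;q)_\infty=\prod_{m=0}^{n-1}(1-aq^m)$ for integers $n\ge0$, and $(a_1,\dots,a_r;q)_\infty=(a_1;q)_\infty\cdots(a_r;q)_\infty$; the same notation is used with the base $q$ replaced by a power of $q$. *)

theory Defs
  imports "HOL-Analysis.Analysis"
begin

text \<open>
  The infinite $q$-Pochhammer symbol $(a;q)_\infty$. For $|q| < 1$ the product converges in the sense
  of the library predicate \<open>convergent_prod\<close>, also when one of its factors vanishes.
\<close>
definition qpoch_inf :: "complex \<Rightarrow> complex \<Rightarrow> complex" where
  "qpoch_inf a q = (\<Prod>m. 1 - a * q ^ m)"

text \<open>
  The finite symbol $(a;q)_n$, in the product form: the quotient $(a;q)_\infty / (aq^n;q)_\infty$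
  would be \<open>0 / 0\<close> for some \<open>a\<close>.
\<close>
definition qpoch :: "complex \<Rightarrow> complex \<Rightarrow> nat \<Rightarrow> complex" where
  "qpoch a q n = (\<Prod>m<n. 1 - a * q ^ m)"

definition qpoch_inf_list :: "complex list \<Rightarrow> complex \<Rightarrow> complex" where
  "qpoch_inf_list as q = (\<Prod>a\<leftarrow>as. qpoch_inf a q)"

end

theory Submission
  imports Defs
begin

text \<open>
  Put \<open>p = q\<^sup>2\<close>. Each identity is a case of the Bailey machinery. For fixed \<open>k\<close> the sum over \<open>i\<close> is Euler's
  series for \<open>(-q\<^bsup>2k+1\<^esup>; p)\<^sub>\<infinity>\<close> (for \<open>(-q\<^bsup>2k+3\<^esup>; p)\<^sub>\<infinity>\<close> in the fourth identity), that is, \<open>(-q; p)\<^sub>\<infinity>\<close> divided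
  by a finite product. With \<open>N = j + k\<close> the exponent of what remains is \<open>2N\<^sup>2 + 2k\<^sup>2\<close> plus linear terms, so
  up to the factor \<open>(-q; p)\<^sub>\<infinity>\<close> the left-hand side becomes
     \<open>\<Sum>\<^sub>N p\<^bsup>N\<^sup>2 + eN\<^esup> \<Sum>\<^bsub>k\<le>N\<^esub> p\<^bsup>k\<^sup>2 + ek\<^esup> \<beta>\<^sub>k / (p; p)\<^bsub>N-k\<^esub>\<close>
  with \<open>e \<in> {0, 1}\<close>. Here \<open>\<beta>\<^sub>k\<close> is \<open>1 / ((q\<^sup>4; q\<^sup>4)\<^sub>k (-q; p)\<^sub>k)\<close> or a slight variant, and
  it belongs to a Bailey pair: it is a bilateral sum
     \<open>\<beta>\<^sub>k = \<Sum>\<^sub>r A\<^sub>r / ((p; p)\<^bsub>k-r\<^esub> (p; p)\<^bsub>k+e+r\<^esub>)\<close>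
  whose weights \<open>A\<^sub>r\<close> are those of a theta series with base \<open>q\<^sup>3\<close>. Bailey's lemma multiplies the weights
  by \<open>p\<^bsup>r\<^sup>2 + er\<^esup>\<close>; two applications turn the base \<open>q\<^sup>3\<close> into \<open>q\<^sup>3 q\<^sup>4 q\<^sup>4 = q\<^bsup>11\<^esup>\<close>, and Jacobi's triple
  product evaluates the resulting theta series.

  The Bailey pairs are lemmas \<open>bailey_pair_diagonal_2\<close>, \<open>diagonal_3_eq_diagonal_2\<close>,
  \<open>off_diagonal_1_eq_diagonal_2\<close> and \<open>bailey_pair_off_diagonal_2\<close>. All four follow from the symmetries of
  the bilateral sums and the recurrence \<open>(p; p)\<^bsub>m+1\<^esub> = (1 - p\<^bsup>m+1\<^esup>) (p; p)\<^sub>m\<close>. Bailey's lemma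
  (\<open>bailey_lemma\<close>) is an interchange of summation on top of the \<open>q\<close>-Vandermonde sum. Everything is done for
  finite \<open>n\<close>, where the sums have finite support; then \<open>n\<close> tends to infinity by Tannery's theorem
  (\<open>infsum_bounded_weights_tendsto\<close>). Euler's series and the triple product are limits of one finite
  identity, \<open>finite_jacobi\<close>. The point \<open>q = 0\<close> is treated apart, because negative powers of \<open>q\<close> occur in the
  argument.
\<close>

section \<open>Bilateral sums\<close>

lemma qpoch_0 [simp]: "qpoch a p 0 = 1"
  by (simp add: qpoch_def)

lemma qpoch_Suc: "qpoch a p (Suc n) = qpoch a p n * (1 - a * p ^ n)"
  by (simp add: qpoch_def)

lemma one_minus_power_neq_0:
  fixes p :: complex
  assumes "norm p < 1" "n > 0"
  shows "1 - p ^ n \<noteq> 0"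
proof
  assume "1 - p ^ n = 0"
  hence "norm p ^ n = 1" by (metis eq_iff_diff_eq_0 norm_one norm_power)
  moreover have "norm p ^ n < 1"
    using assms by (intro power_less_one_iff[THEN iffD2]) auto
  ultimately show False by simp
qed

lemma qpoch_neq_0:
  assumes "norm p < 1"
  shows "qpoch p p n \<noteq> 0"
  using one_minus_power_neq_0[OF assms, of "Suc _"] by (simp add: qpoch_def)

text \<open>
  The value \<open>0\<close> at negative \<open>m\<close> is the convention under which \<open>(p; p)\<^bsub>m\<^esub> = (1 - p\<^sup>m) (p; p)\<^bsub>m-1\<^esub>\<close> holds
  for every integer \<open>m\<close> once it is written for reciprocals. It makes the bilateral sums below finite, so that
  they can be shifted and reflected without attention to their ranges.
\<close>
definition recip_qpoch :: "complex \<Rightarrow> int \<Rightarrow> complex" where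
  "recip_qpoch p m = (if m < 0 then 0 else 1 / qpoch p p (nat m))"

lemma recip_qpoch_of_nat [simp]: "recip_qpoch p (int n) = 1 / qpoch p p n"
  by (simp add: recip_qpoch_def)

lemma recip_qpoch_neg: "m < 0 \<Longrightarrow> recip_qpoch p m = 0"
  by (simp add: recip_qpoch_def)

lemma recip_qpoch_step:
  assumes "norm p < 1"
  shows "recip_qpoch p (m - 1) = (1 - p powi m) * recip_qpoch p m"
proof (cases m rule: int_cases3)
  case (pos n)
  then obtain k where "n = Suc k" by (cases n) auto
  hence [simp]: "m = 1 + int k" "nat (1 + int k) = Suc k" using pos by auto
  have "m = int (Suc k)" by simp
  hence "p powi m = p ^ Suc k" by (simp only: power_int_of_nat)
  thus ?thesis using one_minus_power_neq_0[OF assms, of "Suc k"]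
    by (simp add: recip_qpoch_def qpoch_Suc)
qed (auto simp: recip_qpoch_def)

text \<open>
  The sequence \<open>n \<mapsto> bailey_sum p n (n + e) A\<close> is the \<open>\<beta>\<close> of a Bailey pair with parameter \<open>a = p\<^sup>e\<close>: the
  usual \<open>\<alpha>\<^sub>r\<close> for \<open>r \<ge> 0\<close> is obtained by collecting the terms \<open>r\<close> and \<open>-e - r\<close>, which have the same
  denominator, and for \<open>e = 1\<close> dividing by \<open>1 - p\<close>, because the standard denominator has \<open>(ap; p)\<^bsub>n+r\<^esub>\<close>
  in place of \<open>(p; p)\<^bsub>n+e+r\<^esub>\<close>.
\<close>
definition bailey_sum :: "complex \<Rightarrow> int \<Rightarrow> int \<Rightarrow> (int \<Rightarrow> complex) \<Rightarrow> complex" where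
  "bailey_sum p n m A = (\<Sum>\<^sub>\<infinity>r. A r * recip_qpoch p (n - r) * recip_qpoch p (m + r))"

lemma bailey_sum_eq_sum:
  "bailey_sum p n m A = (\<Sum>r\<in>{-m..n}. A r * recip_qpoch p (n - r) * recip_qpoch p (m + r))"
proof -
  have "bailey_sum p n m A
      = infsum (\<lambda>r. A r * recip_qpoch p (n - r) * recip_qpoch p (m + r)) {-m..n}"
    unfolding bailey_sum_def
    by (rule infsum_cong_neutral) (auto simp: recip_qpoch_def)
  thus ?thesis by simp
qed

lemma bailey_sum_add:
  "bailey_sum p n m (\<lambda>r. A r + B r) = bailey_sum p n m A + bailey_sum p n m B"
  by (simp add: bailey_sum_eq_sum sum.distrib algebra_simps)

lemma bailey_sum_cmult: "bailey_sum p n m (\<lambda>r. c * A r) = c * bailey_sum p n m A"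
  by (simp add: bailey_sum_eq_sum sum_distrib_left algebra_simps)

lemma bailey_sum_shift: "bailey_sum p n m A = bailey_sum p (n - 1) (m + 1) (\<lambda>r. A (r + 1))"
  unfolding bailey_sum_def
  by (rule infsum_reindex_bij_witness[of _ "\<lambda>r. r + 1" "\<lambda>r. r - 1"]) (auto simp: algebra_simps)

lemma bailey_sum_reflect: "bailey_sum p n m A = bailey_sum p m n (\<lambda>r. A (- r))"
  unfolding bailey_sum_def
  by (rule infsum_reindex_bij_witness[of _ uminus uminus]) (auto simp: algebra_simps)

text \<open>
  Substituting \<open>1 / (p; p)\<^bsub>m+r\<^esub> = (1 - p\<^bsup>m+1\<^esup> p\<^sup>r) / (p; p)\<^bsub>m+1+r\<^esub>\<close> in each term raises \<open>m\<close>, at the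
  price of a second sum with weights twisted by \<open>p\<^sup>r\<close>. For theta weights this twist only rescales the
  argument.
\<close>
lemma bailey_sum_lower_right:
  assumes "norm p < 1" "p \<noteq> 0"
  shows "bailey_sum p n m A = bailey_sum p n (m + 1) A
           - p powi (m + 1) * bailey_sum p n (m + 1) (\<lambda>r. A r * p powi r)"
proof -
  have "A r * recip_qpoch p (n - r) * recip_qpoch p (m + r)
      = (A r + (- (p powi (m + 1))) * (A r * p powi r))
          * recip_qpoch p (n - r) * recip_qpoch p (m + 1 + r)" for r
  proof -
    have "p powi (m + 1 + r) = p powi (m + 1) * p powi r"
      by (rule power_int_add) (use assms(2) in simp)
    hence "recip_qpoch p (m + r) = (1 - p powi (m + 1) * p powi r) * recip_qpoch p (m + 1 + r)"
      using recip_qpoch_step[OF assms(1), of "m + 1 + r"] by simp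
    hence "A r * recip_qpoch p (n - r) * recip_qpoch p (m + r)
      = A r * recip_qpoch p (n - r) * ((1 - p powi (m + 1) * p powi r) * recip_qpoch p (m + 1 + r))"
      by (simp only:)
    also have "\<dots> = (A r + (- (p powi (m + 1))) * (A r * p powi r))
          * recip_qpoch p (n - r) * recip_qpoch p (m + 1 + r)"
      by (simp add: ring_distribs mult_ac)
    finally show ?thesis .
  qed
  hence "bailey_sum p n m A
      = bailey_sum p n (m + 1) (\<lambda>r. A r + (- (p powi (m + 1))) * (A r * p powi r))"
    unfolding bailey_sum_def by (simp only:)
  thus ?thesis by (simp only: bailey_sum_add bailey_sum_cmult) simp
qed

lemma bailey_sum_lower_left:
  assumes "norm p < 1" "p \<noteq> 0"
  shows "bailey_sum p n m A = bailey_sum p (n + 1) m A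
           - p powi (n + 1) * bailey_sum p (n + 1) m (\<lambda>r. A r * p powi (- r))"
  using bailey_sum_lower_right[OF assms, of m n "\<lambda>r. A (- r)"]
    bailey_sum_reflect[of p n m A] bailey_sum_reflect[of p "n + 1" m A]
    bailey_sum_reflect[of p "n + 1" m "\<lambda>r. A r * p powi (- r)"]
  by simp

text \<open>
  The general term of the theta series in Jacobi's triple product. The same family also supplies the
  weights of all Bailey pairs used here, only with a base \<open>Q\<close> different from \<open>p\<close>.
\<close>
definition theta_weight :: "complex \<Rightarrow> complex \<Rightarrow> int \<Rightarrow> complex" where
  "theta_weight z Q r = (- z) powi r * Q powi (r * (r - 1) div 2)"

lemma triangular_Suc: "(r + 1) * r div 2 = r * (r - 1) div 2 + (r::int)"
proof -
  have "(r + 1) * r = r * (r - 1) + r * 2" by (simp add: algebra_simps)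
  thus ?thesis by (metis div_mult_self1 zero_neq_numeral add.commute mult.commute)
qed

lemma theta_weight_Suc:
  assumes "z \<noteq> 0" "Q \<noteq> 0"
  shows "theta_weight z Q (r + 1) = (- z) * theta_weight (z * Q) Q r"
proof -
  have "(- (z * Q)) powi r = (- z) powi r * Q powi r"
    by (metis mult_minus_left power_int_mult_distrib)
  thus ?thesis using assms triangular_Suc[of r]
    by (simp add: theta_weight_def power_int_add)
qed

lemma theta_weight_reflect:
  assumes "z \<noteq> 0" "Q \<noteq> 0"
  shows "theta_weight z Q (- r) = theta_weight (Q / z) Q r"
proof -
  have "(- r) * (- r - 1) div 2 = r * (r - 1) div 2 + r"
    using triangular_Suc[of r] by (simp add: algebra_simps)
  moreover have "(- (Q / z)) powi r = Q powi r * (- z) powi (- r)"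
  proof -
    have "- (Q / z) = Q * inverse (- z)"
      by (simp add: divide_inverse)
    thus ?thesis by (simp only: power_int_mult_distrib power_int_inverse power_int_minus)
  qed
  ultimately show ?thesis using assms
    by (simp add: theta_weight_def power_int_add)
qed

lemma theta_weight_scale: "theta_weight z Q r * c powi r = theta_weight (z * c) Q r"
proof -
  have "(- (z * c)) powi r = (- z) powi r * c powi r"
    by (metis mult_minus_left power_int_mult_distrib)
  thus ?thesis by (simp add: theta_weight_def)
qed

lemma bailey_theta_reflect:
  assumes "z \<noteq> 0" "Q \<noteq> 0"
  shows "bailey_sum p n m (theta_weight z Q) = bailey_sum p m n (theta_weight (Q / z) Q)"
  unfolding bailey_sum_reflect[of p n m "theta_weight z Q"] theta_weight_reflect[OF assms] ..

lemma bailey_theta_shift: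
  assumes "z \<noteq> 0" "Q \<noteq> 0"
  shows "bailey_sum p n m (theta_weight z Q)
       = - z * bailey_sum p (n - 1) (m + 1) (theta_weight (z * Q) Q)"
  unfolding bailey_sum_shift[of p n m "theta_weight z Q"] theta_weight_Suc[OF assms]
  by (rule bailey_sum_cmult)

lemma bailey_theta_lower_right:
  assumes "norm p < 1" "p \<noteq> 0"
  shows "bailey_sum p n m (theta_weight z Q) = bailey_sum p n (m + 1) (theta_weight z Q)
           - p powi (m + 1) * bailey_sum p n (m + 1) (theta_weight (z * p) Q)"
  using bailey_sum_lower_right[OF assms, of n m "theta_weight z Q"]
  by (simp only: theta_weight_scale)

lemma bailey_theta_lower_left:
  assumes "norm p < 1" "p \<noteq> 0"
  shows "bailey_sum p n m (theta_weight z Q) = bailey_sum p (n + 1) m (theta_weight z Q)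
           - p powi (n + 1) * bailey_sum p (n + 1) m (theta_weight (z / p) Q)"
proof -
  have "p powi (- r) = inverse p powi r" for r
    by (simp only: power_int_minus power_int_inverse)
  hence "theta_weight z Q r * p powi (- r) = theta_weight (z / p) Q r" for r
    using theta_weight_scale[of z Q r "inverse p"] by (simp add: divide_inverse)
  thus ?thesis using bailey_sum_lower_left[OF assms, of n m "theta_weight z Q"] by simp
qed

section \<open>Four Bailey pairs\<close>

text \<open>
  With \<open>p = t\<^sup>2\<close>, \<open>Q = t\<^sup>3\<close> and argument \<open>t\<^sup>c\<close>, the sums \<open>T n n (W c)\<close> and \<open>T n (n + 1) (W c)\<close> for small
  \<open>c\<close> are tied together: reflection relates \<open>c\<close> to \<open>3 - c\<close> on the diagonal and to \<open>6 - c\<close> off it, and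
  the recurrence for \<open>(p; p)\<^sub>m\<close> relates the diagonal to its neighbour with \<open>c\<close> shifted by \<open>2\<close>. Since
  \<open>c = 3\<close> is its own off-diagonal mirror image, with a minus sign, one of the sums vanishes, and everything
  else becomes a multiple of \<open>T n n (W 2)\<close>, which then satisfies a recurrence of order one in \<open>n\<close>.
\<close>

context
  fixes t :: complex
  assumes t: "norm t < 1" "t \<noteq> 0"
begin

private abbreviation "W c \<equiv> theta_weight (t ^ c) (t ^ 3)"
private abbreviation "T \<equiv> bailey_sum (t ^ 2)"

private lemma p: "norm (t ^ 2) < 1" "t ^ 2 \<noteq> 0"
  using t power_less_one_iff[of "norm t" 2] by (simp_all add: norm_power)

text \<open>
  The substitution \<open>r \<mapsto> -1 - r\<close> exchanges the two factors of the denominator; it is a reflection followed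
  by a shift.
\<close>
lemma off_diagonal_antisymmetry:
  "T n (n + 1) (theta_weight z (t ^ 3))
     = - (t ^ 3 / z) * T n (n + 1) (theta_weight (t ^ 6 / z) (t ^ 3))" if "z \<noteq> 0"
proof -
  have "T n (n + 1) (theta_weight z (t ^ 3)) = T (n + 1) n (theta_weight (t ^ 3 / z) (t ^ 3))"
    using that t by (intro bailey_theta_reflect) auto
  also have "\<dots> = - (t ^ 3 / z) * T n (n + 1) (theta_weight (t ^ 3 / z * t ^ 3) (t ^ 3))"
    using that t bailey_theta_shift[of "t ^ 3 / z" "t ^ 3" "t ^ 2" "n + 1" n] by simp
  also have "t ^ 3 / z * t ^ 3 = t ^ 6 / z" by (simp flip: power_add)
  finally show ?thesis .
qed

lemma square_powi_Suc: "(t ^ 2) powi (int n + 1) = t ^ (2 * n + 2)"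
proof -
  have "int n + 1 = int (n + 1)" by simp
  thus ?thesis by (simp only: power_int_of_nat flip: power_mult) simp
qed

lemma one_plus_odd_power_neq_0: "1 + t ^ (2 * n + 1) \<noteq> 0"
  using one_minus_power_neq_0[of "- t" "2 * n + 1"] t by simp

lemma off_diagonal_3_eq_0: "T (int n) (int n + 1) (W 3) = 0"
proof -
  have "t ^ 6 / t ^ 3 = t ^ 3" using t(2) by (simp add: field_simps flip: power_add)
  thus ?thesis using off_diagonal_antisymmetry[of "t ^ 3" "int n"] t by simp
qed

lemma off_diagonal_1_5: "T (int n) (int n + 1) (W 1) = - (t ^ 2) * T (int n) (int n + 1) (W 5)"
proof -
  have "t ^ 6 / t ^ 1 = t ^ 5" "t ^ 3 / t ^ 1 = t ^ 2"
    using t(2) power_diff[of t 1 6] power_diff[of t 1 3] by simp_all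
  thus ?thesis using off_diagonal_antisymmetry[of "t ^ 1" "int n"] t by simp
qed

lemma off_diagonal_2_4: "T (int n) (int n + 1) (W 2) = - t * T (int n) (int n + 1) (W 4)"
proof -
  have "t ^ 6 / t ^ 2 = t ^ 4" "t ^ 3 / t ^ 2 = t"
    using t(2) power_diff[of t 2 6] power_diff[of t 2 3] by simp_all
  thus ?thesis using off_diagonal_antisymmetry[of "t ^ 2" "int n"] t by simp
qed

lemma diagonal_1_2: "T (int n) (int n) (W 1) = T (int n) (int n) (W 2)"
proof -
  have "t ^ 3 / t ^ 1 = t ^ 2" using t(2) power_diff[of t 1 3] by simp
  thus ?thesis
    using bailey_theta_reflect[of "t ^ 1" "t ^ 3" "t ^ 2" "int n" "int n"] t by simp
qed

lemma diagonal_0_3: "T (int n) (int n) (W 0) = T (int n) (int n) (W 3)"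
  using bailey_theta_reflect[of 1 "t ^ 3" "t ^ 2" "int n" "int n"] t
  by simp

lemma power_times_square: "t ^ a * t ^ 2 = t ^ (a + 2)"
  by (simp only: power_add)

lemma off_diagonal_1_eq_diagonal_2: "T (int n) (int n + 1) (W 1) = T (int n) (int n) (W 2)"
proof -
  have "t ^ 1 * t ^ 2 = t ^ 3" by (simp add: power3_eq_cube power2_eq_square)
  thus ?thesis
    using bailey_theta_lower_right[OF p, of "int n" "int n" "t ^ 1" "t ^ 3"]
      off_diagonal_3_eq_0[of n] diagonal_1_2[of n]
    by (simp only:) simp
qed

lemma diagonal_2_eq_off_diagonal_2:
  "T (int n) (int n) (W 2) = (1 + t ^ (2 * n + 1)) * T (int n) (int n + 1) (W 2)"
proof -
  have "T (int n) (int n) (W 2)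
     = T (int n) (int n + 1) (W 2) - t ^ (2 * n + 2) * T (int n) (int n + 1) (W 4)"
    using bailey_theta_lower_right[OF p, of "int n" "int n" "t ^ 2" "t ^ 3"] square_powi_Suc[of n]
    by (simp only: power_times_square) simp
  thus ?thesis using off_diagonal_2_4[of n] by (simp add: algebra_simps)
qed

lemma diagonal_3_eq_diagonal_2: "T (int n) (int n) (W 3) = t ^ (2 * n) * T (int n) (int n) (W 2)"
proof -
  have "T (int n) (int n) (W 3) = - (t ^ (2 * n + 2)) * T (int n) (int n + 1) (W 5)"
    using bailey_theta_lower_right[OF p, of "int n" "int n" "t ^ 3" "t ^ 3"]
      square_powi_Suc[of n] off_diagonal_3_eq_0[of n]
    by (simp only: power_times_square) simp
  also have "\<dots> = t ^ (2 * n) * (- (t ^ 2) * T (int n) (int n + 1) (W 5))"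
    by (simp only: power_add mult_ac mult_minus_left mult_minus_right)
  finally show ?thesis by (simp only: off_diagonal_1_5[of n, symmetric] off_diagonal_1_eq_diagonal_2)
qed

text \<open>
  Raising the left index instead of the right one links \<open>n\<close> to \<open>n + 1\<close>. The twisted sum has argument \<open>1\<close>,
  and reflection returns it to argument \<open>t\<^sup>3\<close>, already known as a multiple of the sum with argument \<open>t\<^sup>2\<close>.
\<close>
lemma off_diagonal_2_eq_next_diagonal_2:
  "T (int n) (int n + 1) (W 2) = (1 - t ^ (4 * n + 4)) * T (int (Suc n)) (int (Suc n)) (W 2)"
proof -
  have "T (int n) (int n + 1) (W 2) = T (int n + 1) (int n + 1) (W 2)
     - t ^ (2 * n + 2) * T (int n + 1) (int n + 1) (W 0)"
    using bailey_theta_lower_left[OF p, of "int n" "int n + 1" "t ^ 2" "t ^ 3"]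
      square_powi_Suc[of n] t
    by simp
  moreover have "int n + 1 = int (Suc n)" by simp
  ultimately have "T (int n) (int n + 1) (W 2) = T (int (Suc n)) (int (Suc n)) (W 2)
     - t ^ (2 * n + 2) * T (int (Suc n)) (int (Suc n)) (W 0)"
    by (simp only:)
  also have "T (int (Suc n)) (int (Suc n)) (W 0)
      = t ^ (2 * n + 2) * T (int (Suc n)) (int (Suc n)) (W 2)"
    using diagonal_0_3[of "Suc n"] diagonal_3_eq_diagonal_2[of "Suc n"] by simp
  finally have *: "T (int n) (int n + 1) (W 2) = T (int (Suc n)) (int (Suc n)) (W 2)
     - t ^ (2 * n + 2) * (t ^ (2 * n + 2) * T (int (Suc n)) (int (Suc n)) (W 2))" .
  have "t ^ (4 * n + 4) = t ^ (2 * n + 2) * t ^ (2 * n + 2)"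
    by (simp only: power_add[symmetric]) (rule arg_cong[of _ _ "\<lambda>k. t ^ k"], simp)
  thus ?thesis using * by (simp only: left_diff_distrib mult.assoc mult_1)
qed

lemma bailey_pair_diagonal_2:
  "T (int n) (int n) (W 2) = 1 / (qpoch (t ^ 4) (t ^ 4) n * qpoch (- t) (t ^ 2) n)"
proof (induction n)
  case 0
  show ?case by (simp add: bailey_sum_eq_sum theta_weight_def recip_qpoch_def)
next
  case (Suc n)
  have "(1 + t ^ (2 * n + 1)) * (1 - t ^ (4 * n + 4)) * T (int (Suc n)) (int (Suc n)) (W 2)
      = T (int n) (int n) (W 2)"
    using diagonal_2_eq_off_diagonal_2[of n] off_diagonal_2_eq_next_diagonal_2[of n] by simp
  moreover have "1 + t ^ (2 * n + 1) \<noteq> 0" "1 - t ^ (4 * n + 4) \<noteq> 0"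
    using one_plus_odd_power_neq_0 one_minus_power_neq_0[OF t(1), of "4 * n + 4"] by auto
  ultimately have "T (int (Suc n)) (int (Suc n)) (W 2)
      = T (int n) (int n) (W 2) / ((1 + t ^ (2 * n + 1)) * (1 - t ^ (4 * n + 4)))"
    by (metis nonzero_mult_div_cancel_left mult_eq_0_iff)
  moreover have "1 - t ^ 4 * (t ^ 4) ^ n = 1 - t ^ (4 * n + 4)"
    by (simp add: power_mult power_add)
  moreover have "1 - (- t) * (t ^ 2) ^ n = 1 + t ^ (2 * n + 1)"
    by (simp add: power_mult power_add)
  ultimately show ?case by (simp only: qpoch_Suc Suc.IH) simp
qed

lemma bailey_pair_off_diagonal_2:
  "T (int n) (int n + 1) (W 2) = 1 / (qpoch (t ^ 4) (t ^ 4) n * qpoch (- t) (t ^ 2) (Suc n))"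
proof -
  have "T (int n) (int n + 1) (W 2) = T (int n) (int n) (W 2) / (1 + t ^ (2 * n + 1))"
    using diagonal_2_eq_off_diagonal_2[of n] one_plus_odd_power_neq_0[of n]
    by (metis nonzero_mult_div_cancel_left)
  moreover have "1 - (- t) * (t ^ 2) ^ n = 1 + t ^ (2 * n + 1)"
    by (simp add: power_mult power_add)
  ultimately show ?thesis by (simp only: qpoch_Suc bailey_pair_diagonal_2) simp
qed

end

section \<open>The Bailey lemma and the finite triple product\<close>

text \<open>
  A form of the \<open>q\<close>-Vandermonde sum. In the induction the factor \<open>1 - p\<^bsup>N+1\<^esup>\<close> is split as
  \<open>(1 - p\<^bsup>N+1-s\<^esup>) + p\<^bsup>N+1-s\<^esup> (1 - p\<^sup>s)\<close>. The first part lowers \<open>N\<close>; the second lowers \<open>s\<close> as well and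
  raises \<open>m\<close>, which is why \<open>m\<close> must stay arbitrary.
\<close>
lemma q_vandermonde:
  assumes "norm p < 1"
  shows "(\<Sum>s\<le>N. p ^ (s ^ 2 + m * s) / (qpoch p p (N - s) * qpoch p p s * qpoch p p (s + m)))
           = 1 / (qpoch p p N * qpoch p p (N + m))"
proof (induction N arbitrary: m)
  case 0
  show ?case by simp
next
  case (Suc N)
  let ?P = "qpoch p p"
  define f where "f = (\<lambda>M m s. p ^ (s ^ 2 + m * s) / (?P (M - s) * ?P s * ?P (s + m)))"
  note nz = qpoch_neq_0[OF assms] one_minus_power_neq_0[OF assms, of "Suc _", simplified]
  have 1: "(\<Sum>s\<le>Suc N. (1 - p ^ (Suc N - s)) * f (Suc N) m s) = (\<Sum>s\<le>N. f N m s)"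
  proof -
    have "(1 - p ^ (Suc N - s)) * f (Suc N) m s = f N m s" if "s \<le> N" for s
      using nz[of "N - s"] that by (simp add: f_def Suc_diff_le qpoch_Suc)
    thus ?thesis by simp
  qed
  have 2: "(\<Sum>s\<le>Suc N. p ^ (Suc N - s) * (1 - p ^ s) * f (Suc N) m s)
      = p ^ (Suc N + m) * (\<Sum>s\<le>N. f N (Suc m) s)"
  proof -
    have "p ^ (Suc N - Suc s) * (1 - p ^ Suc s) * f (Suc N) m (Suc s)
        = p ^ (Suc N + m) * f N (Suc m) s" if "s \<le> N" for s
    proof -
      have "(Suc N - Suc s) + ((Suc s) ^ 2 + m * Suc s) = (Suc N + m) + (s ^ 2 + Suc m * s)"
        using that by (simp add: power2_eq_square)
      hence "p ^ (Suc N - Suc s) * p ^ ((Suc s) ^ 2 + m * Suc s)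
           = p ^ (Suc N + m) * p ^ (s ^ 2 + Suc m * s)"
        by (metis power_add)
      moreover have "u * (1 - p ^ Suc s) * (x / (?P (N - s) * ?P (Suc s) * y))
           = u * x / (?P (N - s) * ?P s * y)" for u x y
        using nz[of s] by (simp add: qpoch_Suc)
      ultimately show ?thesis
        unfolding f_def by (simp del: power_Suc mult_Suc mult_Suc_right)
    qed
    thus ?thesis
      by (subst sum.atMost_Suc_shift) (simp add: sum_distrib_left del: sum.atMost_Suc)
  qed
  have "(1 - p ^ Suc N) * f (Suc N) m s = (1 - p ^ (Suc N - s)) * f (Suc N) m s
         + p ^ (Suc N - s) * (1 - p ^ s) * f (Suc N) m s" if "s \<le> Suc N" for s
  proof -
    have "p ^ (Suc N - s) * p ^ s = p ^ Suc N" using that by (simp flip: power_add)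
    hence "(1 - p ^ Suc N) = (1 - p ^ (Suc N - s)) + p ^ (Suc N - s) * (1 - p ^ s)"
      by (simp only: right_diff_distrib mult_1_right) simp
    thus ?thesis by (simp only: ring_distribs)
  qed
  hence "(1 - p ^ Suc N) * (\<Sum>s\<le>Suc N. f (Suc N) m s)
      = (\<Sum>s\<le>Suc N. (1 - p ^ (Suc N - s)) * f (Suc N) m s
         + p ^ (Suc N - s) * (1 - p ^ s) * f (Suc N) m s)"
    unfolding sum_distrib_left by (intro sum.cong) auto
  also have "\<dots> = 1 / (?P N * ?P (N + m)) + p ^ (Suc N + m) * (1 / (?P N * ?P (N + Suc m)))"
    unfolding sum.distrib 1 2 unfolding f_def Suc.IH ..
  also have "\<dots> = 1 / (?P N * ?P (Suc N + m))"
    using nz[of N] nz[of "N + m"] by (simp add: qpoch_Suc field_simps)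
  finally have "(\<Sum>s\<le>Suc N. f (Suc N) m s) = 1 / (?P N * ?P (Suc N + m)) / (1 - p ^ Suc N)"
    using one_minus_power_neq_0[OF assms, of "Suc N"]
    by (simp only: eq_divide_eq mult.commute) simp
  also have "\<dots> = 1 / (?P (Suc N) * ?P (Suc N + m))"
    by (simp add: qpoch_Suc mult_ac)
  finally show ?case unfolding f_def .
qed

text \<open>
  For \<open>r \<ge> 0\<close> only \<open>k \<ge> r\<close> contribute, and with \<open>k = r + s\<close> the sum is the previous one with
  \<open>N = n - r\<close> and \<open>m = 2r + e\<close>. Both sides are invariant under \<open>r \<mapsto> -e - r\<close>. The condition \<open>e \<le> 1\<close>
  guarantees that every integer is of the form \<open>r'\<close> or \<open>-e - r'\<close> with \<open>r' \<ge> 0\<close>; for \<open>e = 2\<close> and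
  \<open>r = -1\<close> the term \<open>k = -1\<close> would be missing.
\<close>
lemma bilateral_q_vandermonde:
  assumes "norm p < 1" and e: "e \<le> 1"
  shows "(\<Sum>k\<le>n. p ^ (k ^ 2 + e * k) * recip_qpoch p (int n - int k)
             * (recip_qpoch p (int k - r) * recip_qpoch p (int k + int e + r)))
         = p ^ nat (r ^ 2 + int e * r)
             * (recip_qpoch p (int n - r) * recip_qpoch p (int n + int e + r))"
proof -
  have main: "(\<Sum>k\<le>n. p ^ (k ^ 2 + e * k) * recip_qpoch p (int n - int k)
             * (recip_qpoch p (int k - int r) * recip_qpoch p (int k + int e + int r)))
         = p ^ (r ^ 2 + e * r)
             * (recip_qpoch p (int n - int r) * recip_qpoch p (int n + int e + int r))" for r :: nat
  proof (cases "r \<le> n")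
    case False
    thus ?thesis by (simp add: recip_qpoch_neg)
  next
    case True
    define g where "g = (\<lambda>k. p ^ (k ^ 2 + e * k) * recip_qpoch p (int n - int k)
             * (recip_qpoch p (int k - int r) * recip_qpoch p (int k + int e + int r)))"
    have "(\<Sum>k\<le>n. g k) = (\<Sum>k\<in>{r..n}. g k)"
      by (rule sum.mono_neutral_right) (auto simp: g_def recip_qpoch_neg)
    also have "\<dots> = (\<Sum>s\<le>n - r. g (r + s))"
      by (rule sum.reindex_bij_witness[of _ "\<lambda>s. r + s" "\<lambda>k. k - r"]) (use True in auto)
    also have "\<dots> = (\<Sum>s\<le>n - r. p ^ (r ^ 2 + e * r) * (p ^ (s ^ 2 + (2 * r + e) * s)
        / (qpoch p p (n - r - s) * qpoch p p s * qpoch p p (s + (2 * r + e)))))"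
    proof (rule sum.cong)
      fix s assume s: "s \<in> {..n - r}"
      have "(r + s) ^ 2 + e * (r + s) = (r ^ 2 + e * r) + (s ^ 2 + (2 * r + e) * s)"
        by (simp add: power2_eq_square algebra_simps)
      hence 1: "p ^ ((r + s) ^ 2 + e * (r + s)) = p ^ (r ^ 2 + e * r) * p ^ (s ^ 2 + (2 * r + e) * s)"
        by (metis power_add)
      have 2: "int n - int (r + s) = int (n - r - s)" "int (r + s) - int r = int s"
        "int (r + s) + int e + int r = int (s + (2 * r + e))" using s True by auto
      show "g (r + s) = p ^ (r ^ 2 + e * r) * (p ^ (s ^ 2 + (2 * r + e) * s)
        / (qpoch p p (n - r - s) * qpoch p p s * qpoch p p (s + (2 * r + e))))"
        unfolding g_def 1 2 recip_qpoch_of_nat by simp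
    qed simp
    also have "\<dots> = p ^ (r ^ 2 + e * r) * (1 / (qpoch p p (n - r) * qpoch p p (n - r + (2 * r + e))))"
      unfolding sum_distrib_left[symmetric] q_vandermonde[OF assms(1)] ..
    also have "\<dots> = p ^ (r ^ 2 + e * r)
             * (recip_qpoch p (int n - int r) * recip_qpoch p (int n + int e + int r))"
    proof -
      have "int n - int r = int (n - r)" "int n + int e + int r = int (n - r + (2 * r + e))"
        using True by auto
      thus ?thesis by (simp only: recip_qpoch_of_nat) simp
    qed
    finally show ?thesis unfolding g_def .
  qed
  consider r' where "r = int r'" | r' where "r = - int e - int r'"
  proof (cases "r \<ge> 0")
    case True
    thus ?thesis using that(1)[of "nat r"] by simp
  next
    case False
    hence "r \<le> - int e" using e by linarith
    thus ?thesis using that(2)[of "nat (- int e - r)"] by simp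
  qed
  then show ?thesis
  proof cases
    case 1
    have "nat (r ^ 2 + int e * r) = r' ^ 2 + e * r'" unfolding 1
      by (metis nat_int of_nat_add of_nat_mult of_nat_power)
    thus ?thesis using main[of r'] 1 by (simp only:)
  next
    case 2
    have "r ^ 2 + int e * r = int (r' ^ 2 + e * r')" unfolding 2
      by (simp add: power2_eq_square algebra_simps)
    hence 3: "nat (r ^ 2 + int e * r) = r' ^ 2 + e * r'" by (simp only: nat_int)
    have 4: "k - r = k + int e + int r'" "k + int e + r = k - int r'" for k
      using 2 by auto
    show ?thesis using main[of r'] unfolding 3 4
      by (simp only: mult.commute[of "recip_qpoch p (_ + int e + _)"])
  qed
qed

lemma bailey_sum_eq_sum_superset:
  assumes "{- m..n} \<subseteq> S" "finite S"
  shows "bailey_sum p n m A = (\<Sum>r\<in>S. A r * recip_qpoch p (n - r) * recip_qpoch p (m + r))"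
  unfolding bailey_sum_eq_sum
  by (rule sum.mono_neutral_left) (use assms in \<open>auto simp: recip_qpoch_def\<close>)

text \<open>
  Interchanging the sums over \<open>k\<close> and \<open>r\<close> leaves for each \<open>r\<close> a \<open>q\<close>-Vandermonde sum.
\<close>
lemma bailey_lemma:
  assumes "norm p < 1" "e \<le> 1"
  shows "(\<Sum>k\<le>n. p ^ (k ^ 2 + e * k) * bailey_sum p (int k) (int k + int e) A
              * recip_qpoch p (int n - int k))
         = bailey_sum p (int n) (int n + int e) (\<lambda>r. p ^ nat (r ^ 2 + int e * r) * A r)"
proof -
  let ?S = "{- (int n + int e)..int n}"
  have "(\<Sum>k\<le>n. p ^ (k ^ 2 + e * k) * bailey_sum p (int k) (int k + int e) A
              * recip_qpoch p (int n - int k))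
      = (\<Sum>k\<le>n. \<Sum>r\<in>?S. A r * (p ^ (k ^ 2 + e * k) * recip_qpoch p (int n - int k)
             * (recip_qpoch p (int k - r) * recip_qpoch p (int k + int e + r))))"
  proof (rule sum.cong)
    fix k assume "k \<in> {..n}"
    hence "bailey_sum p (int k) (int k + int e) A
        = (\<Sum>r\<in>?S. A r * recip_qpoch p (int k - r) * recip_qpoch p (int k + int e + r))"
      by (intro bailey_sum_eq_sum_superset) auto
    thus "p ^ (k ^ 2 + e * k) * bailey_sum p (int k) (int k + int e) A
              * recip_qpoch p (int n - int k)
      = (\<Sum>r\<in>?S. A r * (p ^ (k ^ 2 + e * k) * recip_qpoch p (int n - int k)
             * (recip_qpoch p (int k - r) * recip_qpoch p (int k + int e + r))))"
      by (simp only: sum_distrib_left sum_distrib_right mult_ac)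
  qed simp
  also have "\<dots> = (\<Sum>r\<in>?S. A r * (p ^ nat (r ^ 2 + int e * r)
             * (recip_qpoch p (int n - r) * recip_qpoch p (int n + int e + r))))"
    unfolding sum.swap[of _ "?S"] sum_distrib_left[symmetric] bilateral_q_vandermonde[OF assms] ..
  also have "\<dots> = bailey_sum p (int n) (int n + int e) (\<lambda>r. p ^ nat (r ^ 2 + int e * r) * A r)"
    unfolding bailey_sum_eq_sum by (simp only: mult_ac)
  finally show ?thesis .
qed

text \<open>
  When the base of the theta weights equals \<open>p\<close>, raising the left index yields a sum with argument \<open>z / p\<close>.
  Lowering its right index and shifting brings it back to argument \<open>z\<close>, so the relations close up to a
  recurrence of order one.
\<close>
lemma finite_jacobi_step:
  assumes "norm p < 1" "p \<noteq> 0" "z \<noteq> 0"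
  shows "(1 - p ^ Suc (n + m)) * bailey_sum p (int (Suc n)) (int m) (theta_weight z p)
       = (1 - z * p ^ n) * bailey_sum p (int n) (int m) (theta_weight z p)"
proof -
  let ?T = "bailey_sum p"
  have "?T (int n) (int m) (theta_weight z p) = ?T (int n + 1) (int m) (theta_weight z p)
      - p ^ Suc n * ?T (int n + 1) (int m) (theta_weight (z / p) p)"
    using bailey_theta_lower_left[OF assms(1,2), of "int n" "int m" z p] power_int_of_nat[of p "Suc n"]
    by (simp add: add.commute del: power_int_of_nat power_Suc)
  moreover have "?T (int n + 1) (int m - 1) (theta_weight (z / p) p)
      = ?T (int n + 1) (int m) (theta_weight (z / p) p)
      - p ^ m * ?T (int n + 1) (int m) (theta_weight z p)"
    using bailey_theta_lower_right[OF assms(1,2), of "int n + 1" "int m - 1" "z / p" p] assms(2) by simp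
  moreover have "?T (int n + 1) (int m - 1) (theta_weight (z / p) p)
      = - (z / p) * ?T (int n) (int m) (theta_weight z p)"
    using bailey_theta_shift[of "z / p" p p "int n + 1" "int m - 1"] assms by simp
  ultimately have "?T (int n) (int m) (theta_weight z p) = ?T (int n + 1) (int m) (theta_weight z p)
      - p ^ Suc n * (p ^ m * ?T (int n + 1) (int m) (theta_weight z p)
        - (z / p) * ?T (int n) (int m) (theta_weight z p))"
    by (simp add: algebra_simps)
  moreover have "p ^ Suc n * (z / p) = z * p ^ n" using assms by simp
  moreover have "p ^ Suc n * p ^ m = p ^ Suc (n + m)" by (simp add: power_add)
  moreover have "int n + 1 = int (Suc n)" by simp
  ultimately show ?thesis
    by (simp only: left_diff_distrib right_diff_distrib mult.assoc[symmetric]) (simp add: algebra_simps)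
qed

text \<open>
  A finite triple product, equivalent to the \<open>q\<close>-binomial theorem. It grows from \<open>n = m = 0\<close> along \<open>n\<close>
  first; growth in \<open>m\<close> is the same step after reflection. The limit \<open>n = m \<rightarrow> \<infinity>\<close> gives Jacobi's triple
  product, and the limit \<open>n \<rightarrow> \<infinity>\<close> for \<open>m = 0\<close> gives Euler's series.
\<close>
lemma finite_jacobi:
  assumes "norm p < 1" "p \<noteq> 0" "z \<noteq> 0"
  shows "bailey_sum p (int n) (int m) (theta_weight z p)
       = qpoch z p n * qpoch (p / z) p m / qpoch p p (n + m)"
proof -
  have solve: "y = a * (c / (b * d))" if "b * y = a * x" "x = c / d" "b \<noteq> 0" for a b c d x y :: complex
  proof -
    have "y = a * x / b" using that(1,3) by (simp add: eq_divide_eq mult.commute)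
    thus ?thesis using that(2) by (simp add: mult.commute)
  qed
  have left: "bailey_sum p (int n) (int 0) (theta_weight w p) = qpoch w p n / qpoch p p n"
    if "w \<noteq> 0" for n w
  proof (induction n)
    case 0
    show ?case by (simp add: bailey_sum_eq_sum theta_weight_def recip_qpoch_def)
  next
    case (Suc n)
    show ?case
      using solve[OF finite_jacobi_step[OF assms(1,2) that, of n 0] Suc.IH]
        one_minus_power_neq_0[OF assms(1), of "Suc n"] by (simp add: qpoch_Suc ac_simps)
  qed
  show ?thesis
  proof (induction m)
    case 0
    show ?case using left[OF assms(3)] by simp
  next
    case (Suc m)
    have refl: "bailey_sum p (int n) (int k) (theta_weight z p)
        = bailey_sum p (int k) (int n) (theta_weight (p / z) p)" for k
      using bailey_theta_reflect[of z p] assms by blast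
    have "p / z \<noteq> 0" using assms by simp
    from solve[OF finite_jacobi_step[OF assms(1,2) this, of m n, folded refl] Suc.IH]
    show ?case using one_minus_power_neq_0[OF assms(1), of "Suc (n + m)"]
      by (simp add: qpoch_Suc ac_simps)
  qed
qed

section \<open>Limits\<close>

text \<open>
  Tannery's theorem over an arbitrary index set, in the form in which all limits of this proof occur: the
  weights \<open>c n x\<close> tend to a constant \<open>L\<close>, without uniformity in \<open>x\<close> but boundedly. A finite part of the sum
  converges termwise, and the rest is controlled by the tail of \<open>\<Sum> |A x|\<close>.
\<close>
lemma infsum_bounded_weights_tendsto:
  fixes A :: "'a \<Rightarrow> complex" and c :: "nat \<Rightarrow> 'a \<Rightarrow> complex"
  assumes A: "(\<lambda>x. norm (A x)) summable_on S"
    and bound: "\<And>n x. x \<in> S \<Longrightarrow> norm (c n x) \<le> C"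
    and lim: "\<And>x. x \<in> S \<Longrightarrow> (\<lambda>n. c n x) \<longlonglongrightarrow> L"
  shows "(\<lambda>n. \<Sum>\<^sub>\<infinity>x\<in>S. A x * c n x) \<longlonglongrightarrow> (\<Sum>\<^sub>\<infinity>x\<in>S. A x) * L"
proof (cases "S = {}")
  case True
  thus ?thesis by simp
next
  case False
  then obtain x0 where x0: "x0 \<in> S" by blast
  have C0: "C \<ge> 0" using bound[OF x0, of 0] norm_ge_zero order_trans by blast
  have L: "norm L \<le> C"
    by (rule Lim_norm_ubound[OF _ lim[OF x0]]) (use bound[OF x0] in auto)
  have dist_bound: "norm (c n x - L) \<le> 2 * C" if "x \<in> S" for n x
    using norm_triangle_ineq4[of "c n x" L] bound[OF that, of n] L by linarith
  have AL: "(\<lambda>x. norm (A x * (c n x - L))) summable_on S" for n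
    by (rule summable_on_comparison_test[OF summable_on_cmult_left[OF A, of "2 * C"]])
       (use dist_bound in \<open>auto simp: norm_mult intro!: mult_left_mono\<close>)
  have diff: "(\<Sum>\<^sub>\<infinity>x\<in>S. A x * c n x) - (\<Sum>\<^sub>\<infinity>x\<in>S. A x) * L = (\<Sum>\<^sub>\<infinity>x\<in>S. A x * (c n x - L))" for n
  proof -
    have "(\<Sum>\<^sub>\<infinity>x\<in>S. A x * c n x)
        = (\<Sum>\<^sub>\<infinity>x\<in>S. A x * (c n x - L) + A x * L)"
      by (intro infsum_cong) (simp add: algebra_simps)
    also have "\<dots> = (\<Sum>\<^sub>\<infinity>x\<in>S. A x * (c n x - L)) + (\<Sum>\<^sub>\<infinity>x\<in>S. A x * L)"
      by (intro infsum_add abs_summable_summable[OF AL] summable_on_cmult_left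
            abs_summable_summable[OF A])
    finally show ?thesis by (simp add: infsum_cmult_left')
  qed
  show ?thesis
  proof (rule LIM_zero_cancel, unfold diff, rule LIMSEQ_I)
    fix r :: real assume r: "r > 0"
    \<comment> \<open>The tail of the sum costs at most \<open>2C\<epsilon>\<close>; adding \<open>1\<close> avoids dividing by \<open>0\<close> when \<open>C = 0\<close>.\<close>
    define \<epsilon> where "\<epsilon> = r / (2 * (2 * C + 1))"
    have \<epsilon>: "\<epsilon> > 0" using r C0 by (simp add: \<epsilon>_def)
    have C\<epsilon>: "2 * C * \<epsilon> < r / 2" using r C0 by (simp add: \<epsilon>_def field_simps)
    obtain F where F: "finite F" "F \<subseteq> S"
      "dist (\<Sum>x\<in>F. norm (A x)) (\<Sum>\<^sub>\<infinity>x\<in>S. norm (A x)) \<le> \<epsilon>"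
      using infsum_finite_approximation[OF A \<epsilon>] by blast
    have tail: "(\<Sum>\<^sub>\<infinity>x\<in>S - F. norm (A x)) \<le> \<epsilon>"
    proof -
      have "(\<Sum>\<^sub>\<infinity>x\<in>S. norm (A x)) = (\<Sum>\<^sub>\<infinity>x\<in>F. norm (A x)) + (\<Sum>\<^sub>\<infinity>x\<in>S - F. norm (A x))"
        using infsum_Un_disjoint[of "\<lambda>x. norm (A x)" F "S - F"] F
          summable_on_subset_banach[OF A, of "S - F"] by (simp add: Un_absorb1)
      thus ?thesis using F by (simp add: dist_real_def)
    qed
    have "(\<lambda>n. \<Sum>x\<in>F. norm (A x) * norm (c n x - L)) \<longlonglongrightarrow> (\<Sum>x\<in>F. norm (A x) * norm (L - L))"
      using F by (intro tendsto_intros lim) auto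
    hence "(\<lambda>n. \<Sum>x\<in>F. norm (A x) * norm (c n x - L)) \<longlonglongrightarrow> 0" by simp
    then obtain n0 where n0: "\<And>n. n \<ge> n0 \<Longrightarrow> (\<Sum>x\<in>F. norm (A x) * norm (c n x - L)) < r / 2"
      using LIMSEQ_D[of "\<lambda>n. \<Sum>x\<in>F. norm (A x) * norm (c n x - L)" 0 "r / 2"] r
      by (fastforce simp: abs_less_iff)
    have "norm (\<Sum>\<^sub>\<infinity>x\<in>S. A x * (c n x - L)) < r" if "n \<ge> n0" for n
    proof -
      have "norm (\<Sum>\<^sub>\<infinity>x\<in>S. A x * (c n x - L)) \<le> (\<Sum>\<^sub>\<infinity>x\<in>S. norm (A x * (c n x - L)))"
        by (rule norm_infsum_bound[OF AL])
      also have "\<dots> = (\<Sum>\<^sub>\<infinity>x\<in>F. norm (A x * (c n x - L))) + (\<Sum>\<^sub>\<infinity>x\<in>S - F. norm (A x * (c n x - L)))"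
        using infsum_Un_disjoint[of "\<lambda>x. norm (A x * (c n x - L))" F "S - F"] F
          summable_on_subset_banach[OF AL, of "S - F"] by (simp add: Un_absorb1)
      also have "(\<Sum>\<^sub>\<infinity>x\<in>F. norm (A x * (c n x - L))) < r / 2"
        using n0[OF that] F by (simp add: norm_mult)
      also have "(\<Sum>\<^sub>\<infinity>x\<in>S - F. norm (A x * (c n x - L))) \<le> (\<Sum>\<^sub>\<infinity>x\<in>S - F. norm (A x) * (2 * C))"
      proof (rule infsum_mono)
        show "(\<lambda>x. norm (A x * (c n x - L))) summable_on S - F"
          by (rule summable_on_subset_banach[OF AL]) auto
        show "(\<lambda>x. norm (A x) * (2 * C)) summable_on S - F"
          by (intro summable_on_cmult_left summable_on_subset_banach[OF A]) auto
      qed (use dist_bound in \<open>auto simp: norm_mult intro!: mult_left_mono\<close>)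
      also have "\<dots> = (\<Sum>\<^sub>\<infinity>x\<in>S - F. norm (A x)) * (2 * C)"
        by (rule infsum_cmult_left')
      also have "\<dots> \<le> \<epsilon> * (2 * C)" using tail C0 by (intro mult_right_mono) auto
      also have "\<dots> < r / 2" using C\<epsilon> by (simp add: mult.commute)
      finally show ?thesis by simp
    qed
    thus "\<exists>n0. \<forall>n\<ge>n0. norm ((\<Sum>\<^sub>\<infinity>x\<in>S. A x * (c n x - L)) - 0) < r" by auto
  qed
qed

lemma convergent_qpoch:
  fixes a p :: complex
  assumes "norm p < 1"
  shows "convergent_prod (\<lambda>m. 1 - a * p ^ m)"
proof -
  have "summable (\<lambda>m. norm a * norm p ^ m)"
    using assms by (intro summable_mult summable_geometric) auto
  hence "summable (\<lambda>m. norm ((1 - a * p ^ m) - 1))"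
    by (simp add: norm_mult norm_power)
  thus ?thesis
    using abs_convergent_prod_conv_summable abs_convergent_prod_imp_convergent_prod by blast
qed

lemma qpoch_LIMSEQ:
  assumes "norm p < 1"
  shows "(\<lambda>n. qpoch a p n) \<longlonglongrightarrow> qpoch_inf a p"
  using convergent_prod_LIMSEQ[OF convergent_qpoch[OF assms, of a]]
  unfolding qpoch_inf_def qpoch_def by (simp add: LIMSEQ_lessThan_iff_atMost)

lemma qpoch_inf_neq_0:
  assumes "norm p < 1" "norm a < 1"
  shows "qpoch_inf a p \<noteq> 0"
  unfolding qpoch_inf_def
proof (rule prodinf_nonzero[OF convergent_qpoch[OF assms(1)]])
  fix m
  have "norm a * norm p ^ m \<le> norm a * 1"
    using assms by (intro mult_left_mono power_le_one) auto
  hence "norm (a * p ^ m) < 1" using assms by (simp add: norm_mult norm_power)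
  thus "1 - a * p ^ m \<noteq> 0" by (metis eq_iff_diff_eq_0 norm_one less_irrefl)
qed

lemma qpoch_inf_split:
  assumes "norm p < 1"
  shows "qpoch_inf a p = qpoch a p n * qpoch_inf (a * p ^ n) p"
proof (rule LIMSEQ_unique)
  show "(\<lambda>m. qpoch a p (m + n)) \<longlonglongrightarrow> qpoch_inf a p"
    by (rule LIMSEQ_ignore_initial_segment[OF qpoch_LIMSEQ[OF assms]])
  have "qpoch a p (m + n) = qpoch a p n * qpoch (a * p ^ n) p m" for m
    by (induction m) (simp_all add: qpoch_Suc power_add mult_ac)
  thus "(\<lambda>m. qpoch a p (m + n)) \<longlonglongrightarrow> qpoch a p n * qpoch_inf (a * p ^ n) p"
    by (simp only:) (intro tendsto_intros qpoch_LIMSEQ assms)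
qed

lemma recip_qpoch_LIMSEQ:
  assumes "norm p < 1" "filterlim f at_top sequentially"
  shows "(\<lambda>n. recip_qpoch p (f n)) \<longlonglongrightarrow> 1 / qpoch_inf p p"
proof -
  have "(\<lambda>n. recip_qpoch p (int n)) \<longlonglongrightarrow> 1 / qpoch_inf p p"
    unfolding recip_qpoch_of_nat
    by (intro tendsto_divide tendsto_const qpoch_LIMSEQ qpoch_inf_neq_0 assms)
  moreover have "filterlim (\<lambda>n. nat (f n)) at_top sequentially"
    using assms(2) filterlim_compose filterlim_nat_sequentially by blast
  ultimately have "(\<lambda>n. recip_qpoch p (int (nat (f n)))) \<longlonglongrightarrow> 1 / qpoch_inf p p"
    by (rule filterlim_compose)
  moreover have "eventually (\<lambda>n. recip_qpoch p (int (nat (f n))) = recip_qpoch p (f n)) sequentially"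
    using filterlim_at_top[THEN iffD1, OF assms(2), rule_format, of 0]
    by (auto elim!: eventually_mono)
  ultimately show ?thesis by (rule Lim_transform_eventually)
qed

lemma recip_qpoch_bounded:
  assumes "norm p < 1"
  obtains C where "C > 0" "\<And>m. norm (recip_qpoch p m) \<le> C"
proof -
  have "Bseq (\<lambda>n. recip_qpoch p (int n))"
    using recip_qpoch_LIMSEQ[OF assms filterlim_int_sequentially] convergentI convergent_imp_Bseq by blast
  then obtain C where C: "C > 0" "\<And>n. norm (recip_qpoch p (int n)) \<le> C"
    by (auto simp: Bseq_def)
  have "norm (recip_qpoch p m) \<le> C" for m
    using C by (cases m rule: int_cases) (auto simp: recip_qpoch_neg simp del: recip_qpoch_of_nat)
  thus ?thesis using C that by blast
qed

lemma filterlim_int_diff: "filterlim (\<lambda>n. int n - r) at_top sequentially"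
  and filterlim_int_add: "filterlim (\<lambda>n. int n + s + r) at_top sequentially"
proof -
  have "filterlim (\<lambda>n. int n + k) at_top sequentially" for k
    unfolding filterlim_at_top eventually_sequentially
    by (metis add.commute diff_le_eq int_nat_eq le_trans nat_le_iff of_nat_0_le_iff nle_le)
  from this[of "- r"] this[of "s + r"]
  show "filterlim (\<lambda>n. int n - r) at_top sequentially"
    "filterlim (\<lambda>n. int n + s + r) at_top sequentially"
    by (simp_all add: add.assoc)
qed

text \<open>
  Both reciprocal products tend to \<open>1 / (p; p)\<^sub>\<infinity>\<close> for each fixed \<open>r\<close>.
\<close>
lemma bailey_sum_LIMSEQ:
  assumes p: "norm p < 1" and A: "(\<lambda>r. norm (A r)) summable_on UNIV"
  shows "(\<lambda>n. bailey_sum p (int n) (int n + int e) A) \<longlonglongrightarrow> (\<Sum>\<^sub>\<infinity>r. A r) / qpoch_inf p p ^ 2"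
proof -
  obtain C where C: "C > 0" "\<And>m. norm (recip_qpoch p m) \<le> C"
    using recip_qpoch_bounded[OF p] by blast
  have "(\<lambda>n. \<Sum>\<^sub>\<infinity>r. A r * (recip_qpoch p (int n - r) * recip_qpoch p (int n + int e + r)))
          \<longlonglongrightarrow> (\<Sum>\<^sub>\<infinity>r. A r) * (1 / qpoch_inf p p * (1 / qpoch_inf p p))"
  proof (rule infsum_bounded_weights_tendsto[OF A])
    show "norm (recip_qpoch p (int n - r) * recip_qpoch p (int n + int e + r)) \<le> C * C" for n r
      unfolding norm_mult using C by (intro mult_mono) auto
    show "(\<lambda>n. recip_qpoch p (int n - r) * recip_qpoch p (int n + int e + r))
        \<longlonglongrightarrow> 1 / qpoch_inf p p * (1 / qpoch_inf p p)" for r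
      by (intro tendsto_mult recip_qpoch_LIMSEQ p filterlim_int_diff filterlim_int_add)
  qed
  thus ?thesis by (simp add: bailey_sum_def power2_eq_square mult.assoc)
qed

text \<open>
  Bailey's lemma with \<open>n \<rightarrow> \<infinity>\<close> on both sides. The left-hand side contributes one factor \<open>1 / (p; p)\<^sub>\<infinity>\<close>
  and the right-hand side two, one of which cancels.
\<close>
lemma bailey_limit:
  assumes p: "norm p < 1" and e: "e \<le> 1" and A: "(\<lambda>r. norm (A r)) summable_on UNIV"
  shows "(\<lambda>N. norm (p ^ (N ^ 2 + e * N) * bailey_sum p (int N) (int N + int e) A)) summable_on UNIV"
    and "(\<Sum>\<^sub>\<infinity>N. p ^ (N ^ 2 + e * N) * bailey_sum p (int N) (int N + int e) A)
           = (\<Sum>\<^sub>\<infinity>r. p ^ nat (r ^ 2 + int e * r) * A r) / qpoch_inf p p"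
proof -
  define b where "b = (\<lambda>N. p ^ (N ^ 2 + e * N) * bailey_sum p (int N) (int N + int e) A)"
  have A': "(\<lambda>r. norm (p ^ nat (r ^ 2 + int e * r) * A r)) summable_on UNIV"
    using p by (intro summable_on_comparison_test[OF A])
      (auto simp: norm_mult norm_power intro!: mult_left_le_one_le power_le_one)
  have "Bseq (\<lambda>N. bailey_sum p (int N) (int N + int e) A)"
    using bailey_sum_LIMSEQ[OF p A] convergentI convergent_imp_Bseq by blast
  then obtain K where K: "K > 0" "\<And>N. norm (bailey_sum p (int N) (int N + int e) A) \<le> K"
    by (auto simp: Bseq_def)
  have "(\<lambda>N. norm p ^ N) summable_on UNIV"
    using p by (intro summable_nonneg_imp_summable_on summable_geometric) auto
  hence "(\<lambda>N. norm p ^ N * K) summable_on UNIV" by (rule summable_on_cmult_left)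
  hence b: "(\<lambda>N. norm (b N)) summable_on UNIV"
  proof (rule summable_on_comparison_test)
    fix N
    have "norm p ^ (N ^ 2 + e * N) \<le> norm p ^ N"
      using p by (intro power_decreasing) (auto simp: power2_eq_square le_add1 trans_le_add1)
    thus "norm (b N) \<le> norm p ^ N * K"
      unfolding b_def norm_mult norm_power using K(2)[of N] by (intro mult_mono) auto
  qed auto
  thus "(\<lambda>N. norm (p ^ (N ^ 2 + e * N) * bailey_sum p (int N) (int N + int e) A)) summable_on UNIV"
    by (simp add: b_def)
  obtain C where C: "C > 0" "\<And>m. norm (recip_qpoch p m) \<le> C"
    using recip_qpoch_bounded[OF p] by blast
  have "(\<lambda>n. \<Sum>\<^sub>\<infinity>N. b N * recip_qpoch p (int n - int N)) \<longlonglongrightarrow> (\<Sum>\<^sub>\<infinity>N. b N) * (1 / qpoch_inf p p)"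
    by (rule infsum_bounded_weights_tendsto[OF b])
       (use C(2) recip_qpoch_LIMSEQ[OF p filterlim_int_diff] in auto)
  moreover have "(\<Sum>\<^sub>\<infinity>N. b N * recip_qpoch p (int n - int N))
      = bailey_sum p (int n) (int n + int e) (\<lambda>r. p ^ nat (r ^ 2 + int e * r) * A r)" for n
  proof -
    have "(\<Sum>\<^sub>\<infinity>N. b N * recip_qpoch p (int n - int N))
        = infsum (\<lambda>N. b N * recip_qpoch p (int n - int N)) {..n}"
      by (rule infsum_cong_neutral) (auto simp: recip_qpoch_neg)
    thus ?thesis using bailey_lemma[OF p e, where n = n and A = A] by (simp add: b_def)
  qed
  ultimately have "(\<lambda>n. bailey_sum p (int n) (int n + int e) (\<lambda>r. p ^ nat (r ^ 2 + int e * r) * A r))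
      \<longlonglongrightarrow> (\<Sum>\<^sub>\<infinity>N. b N) * (1 / qpoch_inf p p)" by simp
  from LIMSEQ_unique[OF this bailey_sum_LIMSEQ[OF p A']]
  show "(\<Sum>\<^sub>\<infinity>N. p ^ (N ^ 2 + e * N) * bailey_sum p (int N) (int N + int e) A)
           = (\<Sum>\<^sub>\<infinity>r. p ^ nat (r ^ 2 + int e * r) * A r) / qpoch_inf p p"
    using qpoch_inf_neq_0[OF p p]
    by (simp add: divide_simps flip: b_def) (simp add: power2_eq_square mult_ac)
qed

section \<open>The triple product and Euler's series\<close>

lemma triangular_ge: "k \<le> Suc k * k div 2"
proof (cases "k = 0")
  case False
  hence "2 * k \<le> Suc k * k" by (intro mult_right_mono) auto
  thus ?thesis by linarith
qed simp

lemma theta_weight_of_nat: "theta_weight z Q (int s) = (- z) ^ s * Q ^ (s * (s - 1) div 2)"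
proof -
  have "int s * (int s - 1) div 2 = int (s * (s - 1) div 2)"
    by (cases s) (simp_all add: zdiv_int algebra_simps)
  thus ?thesis by (simp only: theta_weight_def power_int_of_nat)
qed

text \<open>
  Only summability of theta weights is at stake, so a geometric bound is enough. It rests on
  \<open>s (s - 1) / 2 \<ge> s - 1\<close>.
\<close>
lemma norm_theta_weight_of_nat:
  assumes "norm Q < 1" "Q \<noteq> 0" "norm z \<le> 1"
  shows "norm (theta_weight z Q (int s)) \<le> norm Q ^ s / norm Q"
proof -
  have "norm (theta_weight z Q (int s)) \<le> 1 * norm Q ^ (s * (s - 1) div 2)"
    unfolding theta_weight_of_nat norm_mult norm_power norm_minus_cancel
    using assms by (intro mult_right_mono power_le_one) auto
  also have "\<dots> \<le> norm Q ^ s / norm Q"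
  proof (cases s)
    case 0
    thus ?thesis using assms by (simp add: field_simps)
  next
    case (Suc k)
    have "norm Q ^ (s * (s - 1) div 2) \<le> norm Q ^ k"
      using assms triangular_ge[of k] Suc by (intro power_decreasing) auto
    thus ?thesis using Suc assms by simp
  qed
  finally show ?thesis .
qed

lemma summable_on_geometric_nat:
  assumes "norm (q :: complex) < 1"
  shows "(\<lambda>n. norm q ^ n * c) summable_on UNIV"
  using assms
  by (intro summable_on_cmult_left summable_nonneg_imp_summable_on summable_geometric) auto

lemma theta_weight_summable:
  assumes "norm Q < 1" "Q \<noteq> 0" "z \<noteq> 0" "norm z \<le> 1" "norm (Q / z) \<le> 1"
  shows "(\<lambda>r. norm (theta_weight z Q r)) summable_on UNIV"
proof -
  have nat: "(\<lambda>s. norm (theta_weight w Q (int s))) summable_on UNIV" if "norm w \<le> 1" for w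
    using summable_on_geometric_nat[OF assms(1), of "1 / norm Q"]
    by (rule summable_on_comparison_test)
       (use norm_theta_weight_of_nat[OF assms(1,2) that] in auto)
  have "(\<lambda>r. norm (theta_weight z Q r)) summable_on range int"
    using nat[OF assms(4)] by (subst summable_on_reindex) (auto simp: o_def)
  moreover have "(\<lambda>r. norm (theta_weight z Q r)) summable_on range (\<lambda>s. - int s)"
    using nat[OF assms(5)]
    by (subst summable_on_reindex) (auto simp: o_def inj_def theta_weight_reflect[OF assms(3,2)])
  moreover have "(UNIV :: int set) = range int \<union> range (\<lambda>s. - int s)"
    by (auto simp: image_iff) (metis int_cases2)
  ultimately show ?thesis using summable_on_union by metis
qed

text \<open>
  The bounds on \<open>|z|\<close> and \<open>|p / z|\<close> make the two halves of the series summable by the geometric bound.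
\<close>
lemma jacobi_triple_product:
  assumes "norm p < 1" "p \<noteq> 0" "z \<noteq> 0" "norm z \<le> 1" "norm (p / z) \<le> 1"
  shows "(\<Sum>\<^sub>\<infinity>r. theta_weight z p r) = qpoch_inf z p * qpoch_inf (p / z) p * qpoch_inf p p"
proof -
  note nz = qpoch_inf_neq_0[OF assms(1) assms(1)]
  have "filterlim (\<lambda>n::nat. n + n) at_top sequentially"
    by (intro filterlim_subseq) (auto simp: strict_mono_def)
  hence "(\<lambda>n. qpoch p p (n + n)) \<longlonglongrightarrow> qpoch_inf p p"
    by (rule filterlim_compose[OF qpoch_LIMSEQ[OF assms(1)]])
  hence "(\<lambda>n. qpoch z p n * qpoch (p / z) p n / qpoch p p (n + n))
      \<longlonglongrightarrow> qpoch_inf z p * qpoch_inf (p / z) p / qpoch_inf p p"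
    by (intro tendsto_intros qpoch_LIMSEQ assms nz)
  moreover have "(\<lambda>n. qpoch z p n * qpoch (p / z) p n / qpoch p p (n + n))
      \<longlonglongrightarrow> (\<Sum>\<^sub>\<infinity>r. theta_weight z p r) / qpoch_inf p p ^ 2"
    using bailey_sum_LIMSEQ[OF assms(1) theta_weight_summable[OF assms], of 0]
    by (simp add: finite_jacobi[OF assms(1-3)])
  ultimately have "qpoch_inf z p * qpoch_inf (p / z) p / qpoch_inf p p
      = (\<Sum>\<^sub>\<infinity>r. theta_weight z p r) / qpoch_inf p p ^ 2"
    by (rule LIMSEQ_unique)
  thus ?thesis using nz by (simp add: divide_simps power2_eq_square mult.assoc)
qed

text \<open>
  With \<open>m = 0\<close> the factor \<open>1 / (p; p)\<^bsub>r\<^esub>\<close> cuts the bilateral series down to \<open>r \<ge> 0\<close>.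
\<close>
lemma euler_has_sum:
  assumes "norm p < 1" "p \<noteq> 0" "x \<noteq> 0" "norm x \<le> 1"
  shows "((\<lambda>i. x ^ i * p ^ (i * (i - 1) div 2) / qpoch p p i) has_sum qpoch_inf (- x) p) UNIV"
proof -
  define f where "f = (\<lambda>i. x ^ i * p ^ (i * (i - 1) div 2) / qpoch p p i)"
  have f: "f i = theta_weight (- x) p (int i) * recip_qpoch p (int i)" for i
    by (simp add: f_def theta_weight_of_nat)
  obtain C where C: "C > 0" "\<And>m. norm (recip_qpoch p m) \<le> C"
    using recip_qpoch_bounded[OF assms(1)] by blast
  have norm_f: "(\<lambda>i. norm (f i)) summable_on UNIV"
    using summable_on_geometric_nat[OF assms(1), of "1 / norm p * C"]
  proof (rule summable_on_comparison_test)
    fix i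
    have "norm (f i) \<le> norm p ^ i / norm p * C"
      unfolding f norm_mult
      by (intro mult_mono norm_theta_weight_of_nat C(2)) (use assms in auto)
    thus "norm (f i) \<le> norm p ^ i * (1 / norm p * C)" by simp
  qed auto
  have "bailey_sum p (int n) 0 (theta_weight (- x) p) = (\<Sum>\<^sub>\<infinity>i. f i * recip_qpoch p (int n - int i))" for n
  proof -
    have "(\<Sum>\<^sub>\<infinity>i. f i * recip_qpoch p (int n - int i))
      = infsum (\<lambda>r. theta_weight (- x) p r * recip_qpoch p (int n - r) * recip_qpoch p (0 + r)) (range int)"
      by (subst infsum_reindex) (auto simp: o_def f mult_ac)
    also have "\<dots> = bailey_sum p (int n) 0 (theta_weight (- x) p)"
      unfolding bailey_sum_def
    proof (rule infsum_cong_neutral)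
      fix r assume "r \<in> UNIV - range int"
      hence "r < 0" by (metis DiffD2 linorder_not_le nonneg_int_cases rangeI)
      thus "theta_weight (- x) p r * recip_qpoch p (int n - r) * recip_qpoch p (0 + r) = 0"
        by (simp add: recip_qpoch_neg)
    qed auto
    finally show ?thesis ..
  qed
  hence eq: "(\<Sum>\<^sub>\<infinity>i. f i * recip_qpoch p (int n - int i)) = qpoch (- x) p n / qpoch p p n" for n
    using finite_jacobi[OF assms(1,2), of "- x" n 0] assms by simp
  have "(\<lambda>n. qpoch (- x) p n / qpoch p p n) \<longlonglongrightarrow> (\<Sum>\<^sub>\<infinity>i. f i) * (1 / qpoch_inf p p)"
    unfolding eq[symmetric]
    by (rule infsum_bounded_weights_tendsto[OF norm_f])
       (use C(2) recip_qpoch_LIMSEQ[OF assms(1) filterlim_int_diff] in auto)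
  moreover have "(\<lambda>n. qpoch (- x) p n / qpoch p p n) \<longlonglongrightarrow> qpoch_inf (- x) p / qpoch_inf p p"
    by (intro tendsto_intros qpoch_LIMSEQ assms qpoch_inf_neq_0)
  ultimately have "(\<Sum>\<^sub>\<infinity>i. f i) * (1 / qpoch_inf p p) = qpoch_inf (- x) p / qpoch_inf p p"
    by (rule LIMSEQ_unique)
  hence "(\<Sum>\<^sub>\<infinity>i. f i) = qpoch_inf (- x) p"
    using qpoch_inf_neq_0[OF assms(1,1)] by simp
  thus ?thesis
    using has_sum_infsum[OF abs_summable_summable[OF norm_f]] unfolding f_def by simp
qed

text \<open>
  What a Bailey step does to theta weights: since \<open>r\<^sup>2 + er = 2 (r (r - 1) / 2) + (1 + e) r\<close>, the new factor
  is absorbed into the base and the argument. The exponent is nonnegative for all integers \<open>r\<close>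
  because \<open>e \<le> 1\<close>.
\<close>
lemma theta_weight_bailey:
  assumes "x \<noteq> 0" "Q \<noteq> 0" "e \<le> 1"
  shows "x ^ nat (r ^ 2 + int e * r) * theta_weight z Q r
           = theta_weight (z * x ^ (1 + e)) (Q * x ^ 2) r"
proof -
  have nonneg: "r ^ 2 + int e * r \<ge> 0"
  proof (cases "r \<ge> 0")
    case False
    hence "r * (r + int e) \<ge> 0" using assms(3) by (intro mult_nonpos_nonpos) auto
    thus ?thesis by (simp add: power2_eq_square algebra_simps)
  qed simp
  define T where "T = r * (r - 1) div 2"
  have "2 * T = r * (r - 1)" unfolding T_def by simp
  hence "r ^ 2 + int e * r = 2 * T + int (1 + e) * r"
    by (simp add: power2_eq_square algebra_simps)
  hence "x ^ nat (r ^ 2 + int e * r) = x powi (2 * T + int (1 + e) * r)"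
    using nonneg by (simp add: power_int_nonneg_exp)
  also have "\<dots> = (x ^ 2) powi T * (x ^ (1 + e)) powi r"
  proof -
    have "x powi (int (1 + e) * r) = (x ^ (1 + e)) powi r"
      by (simp only: power_int_mult power_int_of_nat)
    moreover have "x powi (2 * T) = (x ^ 2) powi T"
      by (simp only: power_int_mult power_int_numeral)
    ultimately show ?thesis using assms(1) by (simp add: power_int_add)
  qed
  finally have "x ^ nat (r ^ 2 + int e * r) = (x ^ 2) powi T * (x ^ (1 + e)) powi r" .
  moreover have "- (z * x ^ (1 + e)) = (- z) * x ^ (1 + e)" by simp
  ultimately show ?thesis
    unfolding theta_weight_def T_def[symmetric]
    by (simp only: power_int_mult_distrib mult_ac)
qed

lemma qpoch_inf_even_odd:
  assumes "norm p < 1"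
  shows "qpoch_inf p (p ^ 2) * qpoch_inf (p ^ 2) (p ^ 2) = qpoch_inf p p"
proof (rule LIMSEQ_unique)
  have p2: "norm (p ^ 2) < 1" using assms by (simp add: norm_power power_less_one_iff)
  have "qpoch p p (2 * n) = qpoch p (p ^ 2) n * qpoch (p ^ 2) (p ^ 2) n" for n
  proof (induction n)
    case (Suc n)
    have "2 * Suc n = Suc (Suc (2 * n))" by simp
    hence "qpoch p p (2 * Suc n)
        = qpoch p (p ^ 2) n * qpoch (p ^ 2) (p ^ 2) n * (1 - p * p ^ (2 * n)) * (1 - p * p ^ Suc (2 * n))"
      by (simp only: qpoch_Suc Suc.IH)
    moreover have "(p ^ 2) ^ n = p ^ (2 * n)" "p ^ 2 * p ^ (2 * n) = p * p ^ Suc (2 * n)"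
      by (simp_all add: power_mult power2_eq_square)
    ultimately show ?case by (simp only: qpoch_Suc mult_ac)
  qed simp
  hence "(\<lambda>n. qpoch p p (2 * n)) \<longlonglongrightarrow> qpoch_inf p (p ^ 2) * qpoch_inf (p ^ 2) (p ^ 2)"
    by (simp only:) (intro tendsto_intros qpoch_LIMSEQ p2)
  thus "(\<lambda>n. qpoch p p (2 * n)) \<longlonglongrightarrow> qpoch_inf p (p ^ 2) * qpoch_inf (p ^ 2) (p ^ 2)" .
  have "filterlim (\<lambda>n::nat. 2 * n) at_top sequentially"
    by (intro filterlim_subseq) (auto simp: strict_mono_def)
  thus "(\<lambda>n. qpoch p p (2 * n)) \<longlonglongrightarrow> qpoch_inf p p"
    by (rule filterlim_compose[OF qpoch_LIMSEQ[OF assms]])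
qed

lemma qpoch_inf_minus_times:
  assumes "norm p < 1"
  shows "qpoch_inf a p * qpoch_inf (- a) p = qpoch_inf (a ^ 2) (p ^ 2)"
proof -
  have "qpoch_inf a p * qpoch_inf (- a) p = (\<Prod>m. (1 - a * p ^ m) * (1 - (- a) * p ^ m))"
    unfolding qpoch_inf_def by (intro prodinf_mult convergent_qpoch assms)
  also have "(\<lambda>m. (1 - a * p ^ m) * (1 - (- a) * p ^ m)) = (\<lambda>m. 1 - a ^ 2 * (p ^ 2) ^ m)"
    by (rule ext) (simp add: algebra_simps power2_eq_square power_mult_distrib)
  finally show ?thesis by (simp add: qpoch_inf_def)
qed

text \<open>
  The chain is \<open>(q; q\<^sup>2)\<^sub>\<infinity> (-q; q\<^sup>2)\<^sub>\<infinity> = (q\<^sup>2; q\<^sup>4)\<^sub>\<infinity>\<close> and \<open>(q\<^sup>2; q\<^sup>4)\<^sub>\<infinity> (q\<^sup>4; q\<^sup>4)\<^sub>\<infinity> = (q\<^sup>2; q\<^sup>2)\<^sub>\<infinity>\<close>.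
\<close>
lemma euler_factor_over_qpoch_inf:
  assumes "norm q < 1"
  shows "qpoch_inf (- q) (q ^ 2) / qpoch_inf (q ^ 2) (q ^ 2)
       = 1 / (qpoch_inf q (q ^ 2) * qpoch_inf (q ^ 4) (q ^ 4))"
proof -
  have q2: "norm (q ^ 2) < 1" and q4: "norm (q ^ 4) < 1"
    using assms by (simp_all add: norm_power power_less_one_iff)
  have sq: "(q ^ 2) ^ 2 = q ^ 4" by simp
  have "qpoch_inf q (q ^ 2) * qpoch_inf (- q) (q ^ 2) * qpoch_inf (q ^ 4) (q ^ 4)
      = qpoch_inf (q ^ 2) (q ^ 2)"
    using qpoch_inf_minus_times[OF q2, of q] qpoch_inf_even_odd[OF q2] by (simp add: sq)
  thus ?thesis
    using qpoch_inf_neq_0[OF q2 assms] qpoch_inf_neq_0[OF q2 q2] qpoch_inf_neq_0[OF q4 q4]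
    by (simp add: divide_simps mult_ac)
qed

section \<open>From Bailey pairs to triple sums\<close>

lemma summable_on_product:
  fixes f :: "'a \<Rightarrow> real" and g :: "'b \<Rightarrow> real"
  assumes "f summable_on A" "g summable_on B" "\<And>x. f x \<ge> 0" "\<And>y. g y \<ge> 0"
  shows "(\<lambda>(x, y). f x * g y) summable_on A \<times> B"
  by (rule summable_on_SigmaI[where g = "\<lambda>x. f x * infsum g B"])
     (use assms in \<open>auto intro!: has_sum_cmult_right summable_on_cmult_left has_sum_infsum\<close>)

text \<open>
  Euler's series with base \<open>q\<^sup>2\<close> and argument \<open>q\<^bsup>2m+1\<^esup>\<close>; the value \<open>(-q\<^bsup>2m+1\<^esup>; q\<^sup>2)\<^sub>\<infinity>\<close> is written so
  that its dependence on \<open>m\<close> sits in a finite product.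
\<close>
lemma euler_gaussian_has_sum:
  assumes "norm q < 1" "q \<noteq> 0"
  shows "((\<lambda>i. q ^ (i ^ 2 + 2 * i * m) / qpoch (q ^ 2) (q ^ 2) i) has_sum
           qpoch_inf (- q) (q ^ 2) / qpoch (- q) (q ^ 2) m) UNIV"
proof -
  have q2: "norm (q ^ 2) < 1" using assms by (simp add: norm_power power_less_one_iff)
  have "(q ^ (2 * m + 1)) ^ i * (q ^ 2) ^ (i * (i - 1) div 2) = q ^ (i ^ 2 + 2 * i * m)" for i
  proof -
    have "2 * (i * (i - 1) div 2) = i * (i - 1)" by (cases i) auto
    moreover have "(2 * m + 1) * i + i * (i - 1) = i ^ 2 + 2 * i * m"
      by (cases i) (auto simp: power2_eq_square algebra_simps)
    ultimately have "(2 * m + 1) * i + 2 * (i * (i - 1) div 2) = i ^ 2 + 2 * i * m"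
      by (simp only:)
    thus ?thesis by (simp only: power_mult[symmetric] power_add[symmetric])
  qed
  moreover have "norm (q ^ (2 * m + 1)) \<le> 1"
    using assms unfolding norm_power by (intro power_le_one) auto
  ultimately have "((\<lambda>i. q ^ (i ^ 2 + 2 * i * m) / qpoch (q ^ 2) (q ^ 2) i) has_sum
      qpoch_inf (- (q ^ (2 * m + 1))) (q ^ 2)) UNIV"
    using euler_has_sum[OF q2, of "q ^ (2 * m + 1)"] assms by (simp del: power_Suc)
  moreover have "qpoch_inf (- q) (q ^ 2) = qpoch (- q) (q ^ 2) m * qpoch_inf (- (q ^ (2 * m + 1))) (q ^ 2)"
    using qpoch_inf_split[OF q2, of "- q" m] by (simp add: power_mult)
  moreover have "qpoch_inf (- q) (q ^ 2) \<noteq> 0"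
    using assms by (intro qpoch_inf_neq_0 q2) auto
  ultimately show ?thesis by auto
qed

text \<open>
  Every exponent is at least \<open>i + j + k\<close> and the reciprocal products are bounded, so a product of three
  geometric series dominates. The term \<open>l\<close> stands for the varying linear part of the exponent.
\<close>
lemma triple_summable:
  assumes "norm q < 1"
  shows "(\<lambda>(i, j, k). q ^ (i ^ 2 + 2 * j ^ 2 + 4 * k ^ 2 + 2 * i * k + 4 * j * k + l i j k) /
          (qpoch (q ^ 2) (q ^ 2) i * qpoch (q ^ 2) (q ^ 2) j * qpoch (q ^ 4) (q ^ 4) k))
        summable_on UNIV"
proof -
  have q2: "norm (q ^ 2) < 1" and q4: "norm (q ^ 4) < 1"
    using assms by (simp_all add: norm_power power_less_one_iff)
  obtain C where C: "C > 0" "\<And>m. norm (recip_qpoch (q ^ 2) m) \<le> C"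
    using recip_qpoch_bounded[OF q2] by blast
  obtain D where D: "D > 0" "\<And>m. norm (recip_qpoch (q ^ 4) m) \<le> D"
    using recip_qpoch_bounded[OF q4] by blast
  have "(\<lambda>(j, k). norm q ^ j * C * (norm q ^ k * D)) summable_on UNIV \<times> UNIV"
    by (rule summable_on_product) (use C D assms summable_on_geometric_nat in auto)
  hence "(\<lambda>(i, jk). norm q ^ i * C * (case jk of (j, k) \<Rightarrow> norm q ^ j * C * (norm q ^ k * D)))
      summable_on UNIV \<times> (UNIV \<times> UNIV)"
    by (intro summable_on_product summable_on_geometric_nat assms) (use C D in auto)
  hence "(\<lambda>(i, j, k). norm q ^ i * C * (norm q ^ j * C * (norm q ^ k * D))) summable_on UNIV"
    by (simp add: case_prod_unfold)
  hence "(\<lambda>x. norm (case x of (i, j, k) \<Rightarrow>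
          q ^ (i ^ 2 + 2 * j ^ 2 + 4 * k ^ 2 + 2 * i * k + 4 * j * k + l i j k) /
          (qpoch (q ^ 2) (q ^ 2) i * qpoch (q ^ 2) (q ^ 2) j * qpoch (q ^ 4) (q ^ 4) k)))
        summable_on UNIV"
  proof (rule summable_on_comparison_test; clarify?)
    fix i j k :: nat
    let ?n = "i ^ 2 + 2 * j ^ 2 + 4 * k ^ 2 + 2 * i * k + 4 * j * k + l i j k"
    have "i \<le> i ^ 2" "j \<le> j ^ 2" "k \<le> k ^ 2" by (simp_all add: power2_eq_square)
    hence "i + j + k \<le> ?n" by linarith
    hence "norm q ^ ?n \<le> norm q ^ (i + j + k)"
      using assms by (intro power_decreasing) auto
    hence "norm q ^ ?n * (norm (recip_qpoch (q ^ 2) (int i)) * norm (recip_qpoch (q ^ 2) (int j))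
             * norm (recip_qpoch (q ^ 4) (int k)))
         \<le> norm q ^ (i + j + k) * (C * C * D)"
      by (intro mult_mono C(2) D(2)) (use C(1) D(1) in auto)
    thus "norm (q ^ ?n / (qpoch (q ^ 2) (q ^ 2) i * qpoch (q ^ 2) (q ^ 2) j * qpoch (q ^ 4) (q ^ 4) k))
        \<le> norm q ^ i * C * (norm q ^ j * C * (norm q ^ k * D))"
      by (simp add: norm_mult norm_divide norm_power power_add mult_ac)
  qed (use C D in auto)
  thus ?thesis by (rule abs_summable_summable)
qed

text \<open>
  The common shape of the four identities. The parameters \<open>d\<close> and \<open>g\<close> record the additional linear terms
  \<open>2di\<close> and \<open>2gk\<close>, \<open>e\<close> is the parameter of the Bailey lemma, and \<open>q\<^sup>c\<close> is the argument of the theta weights.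
  After two Bailey steps this argument is \<open>q\<^bsup>c + 4 + 4e\<^esup>\<close>, and its companion in the triple product with
  base \<open>q\<^bsup>11\<^esup>\<close> is \<open>q\<^bsup>7 - 4e - c\<^esup>\<close>; for \<open>c \<le> 3\<close> and \<open>e \<le> 1\<close> this subtraction does not truncate.
\<close>
lemma triple_sum_of_bailey_pair:
  fixes q :: complex and c d e g :: nat
  assumes q: "norm q < 1" "q \<noteq> 0" and e: "e \<le> 1" and c: "c \<le> 3"
    and pair: "\<And>k. q ^ (2 * g * k) / (qpoch (q ^ 4) (q ^ 4) k * qpoch (- q) (q ^ 2) (k + d))
                = bailey_sum (q ^ 2) (int k) (int k + int e) (theta_weight (q ^ c) (q ^ 3))"
  shows "((\<lambda>(i, j, k). q ^ (i ^ 2 + 2 * j ^ 2 + 4 * k ^ 2 + 2 * i * k + 4 * j * k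
              + (2 * d * i + 2 * e * j + (4 * e + 2 * g) * k)) /
          (qpoch (q ^ 2) (q ^ 2) i * qpoch (q ^ 2) (q ^ 2) j * qpoch (q ^ 4) (q ^ 4) k)) has_sum
      (qpoch_inf (q ^ (c + 4 + 4 * e)) (q ^ 11) * qpoch_inf (q ^ (7 - 4 * e - c)) (q ^ 11)
        * qpoch_inf (q ^ 11) (q ^ 11) / (qpoch_inf q (q ^ 2) * qpoch_inf (q ^ 4) (q ^ 4)))) UNIV"
    (is "(?F has_sum ?rhs) UNIV")
proof -
  let ?p = "q ^ 2"
  let ?P = "qpoch ?p ?p" and ?D = "qpoch (q ^ 4) (q ^ 4)"
  define E where "E = qpoch_inf (- q) ?p"
  have q2: "norm ?p < 1" using q by (simp add: norm_power power_less_one_iff)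
  have q11: "norm (q ^ 11) < 1" using q by (simp add: norm_power power_less_one_iff)
  have norm_le: "norm (q ^ n) \<le> 1" for n
    using q unfolding norm_power by (intro power_le_one) auto
  define S where "S = infsum ?F UNIV"
  have "(?F has_sum S) UNIV" unfolding S_def
    by (intro has_sum_infsum triple_summable q)
  also have "(?F has_sum S) UNIV \<longleftrightarrow>
     ((\<lambda>((N, k), i). ?F (i, N - k, k)) has_sum S) (Sigma (SIGMA N:UNIV. {..N}) (\<lambda>_. UNIV))"
    by (rule has_sum_reindex_bij_witness[of _ "\<lambda>((N, k), i). (i, N - k, k)" "\<lambda>(i, j, k). ((j + k, k), i)"])
       auto
  finally have sum3: "((\<lambda>((N, k), i). ?F (i, N - k, k)) has_sum S)
      (Sigma (SIGMA N:UNIV. {..N}) (\<lambda>_. UNIV))" .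
  \<comment> \<open>The terms that remain after the sum over \<open>i\<close>, indexed by \<open>N = j + k\<close> and \<open>k\<close>.\<close>
  define h where "h = (\<lambda>N k. E * ?p ^ (N ^ 2 + e * N) *
      (?p ^ (k ^ 2 + e * k) * (q ^ (2 * g * k) / (?D k * qpoch (- q) ?p (k + d)))
        * recip_qpoch ?p (int N - int k)))"
  have sum2: "((\<lambda>(N, k). h N k) has_sum S) (SIGMA N:UNIV. {..N})"
  proof (rule has_sum_SigmaD[OF sum3])
    fix x :: "nat \<times> nat" assume "x \<in> (SIGMA N:UNIV. {..N})"
    then obtain N k where x: "x = (N, k)" and "k \<le> N" by auto
    then obtain j where N: "N = j + k" by (metis add.commute le_add_diff_inverse)
    have "((\<lambda>i. q ^ (2 * (N ^ 2 + e * N) + 2 * (k ^ 2 + e * k) + 2 * g * k) / (?P j * ?D k)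
             * (q ^ (i ^ 2 + 2 * i * (k + d)) / ?P i)) has_sum
        q ^ (2 * (N ^ 2 + e * N) + 2 * (k ^ 2 + e * k) + 2 * g * k) / (?P j * ?D k)
             * (E / qpoch (- q) ?p (k + d))) UNIV"
      unfolding E_def by (intro has_sum_cmult_right euler_gaussian_has_sum q)
    moreover have "q ^ (2 * (N ^ 2 + e * N) + 2 * (k ^ 2 + e * k) + 2 * g * k) / (?P j * ?D k)
             * (q ^ (i ^ 2 + 2 * i * (k + d)) / ?P i) = ?F (i, N - k, k)" for i
    proof -
      have "2 * (N ^ 2 + e * N) + 2 * (k ^ 2 + e * k) + 2 * g * k + (i ^ 2 + 2 * i * (k + d))
          = i ^ 2 + 2 * j ^ 2 + 4 * k ^ 2 + 2 * i * k + 4 * j * k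
              + (2 * d * i + 2 * e * j + (4 * e + 2 * g) * k)"
        unfolding N by (simp add: power2_eq_square algebra_simps)
      from arg_cong[OF this, of "\<lambda>n. q ^ n"]
      show ?thesis unfolding N by (simp add: power_add mult_ac)
    qed
    moreover have "q ^ (2 * (N ^ 2 + e * N) + 2 * (k ^ 2 + e * k) + 2 * g * k) / (?P j * ?D k)
             * (E / qpoch (- q) ?p (k + d)) = h N k"
    proof -
      have "int N - int k = int j" using N by simp
      thus ?thesis unfolding h_def
        by (simp only: recip_qpoch_of_nat power_add power_mult) (simp add: mult_ac)
    qed
    ultimately show "((\<lambda>i. (\<lambda>((N, k), i). ?F (i, N - k, k)) (x, i))
        has_sum (\<lambda>(N, k). h N k) x) UNIV"
      unfolding x by simp
  qed
  \<comment> \<open>The weights after the first Bailey step, which is a finite sum over \<open>k \<le> N\<close>.\<close>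
  define A where "A = (\<lambda>r. ?p ^ nat (r ^ 2 + int e * r) * theta_weight (q ^ c) (q ^ 3) r)"
  have "((\<lambda>N. \<Sum>k\<le>N. h N k) has_sum S) UNIV"
    by (rule has_sum_SigmaD[OF sum2]) (auto intro: has_sum_finiteI)
  moreover have "(\<Sum>k\<le>N. h N k)
      = E * (?p ^ (N ^ 2 + e * N) * bailey_sum ?p (int N) (int N + int e) A)" for N
    unfolding h_def pair A_def bailey_lemma[OF q2 e, symmetric]
    by (simp only: sum_distrib_left mult.assoc)
  ultimately have S: "S = E * (\<Sum>\<^sub>\<infinity>N. ?p ^ (N ^ 2 + e * N) * bailey_sum ?p (int N) (int N + int e) A)"
    by (simp add: has_sum_iff infsum_cmult_right')
  have pw: "q ^ a * ?p ^ b = q ^ n" if "n = a + 2 * b" for a b n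
    using that by (simp add: power_add power_mult)
  have A: "A = theta_weight (q ^ (c + 2 + 2 * e)) (q ^ 7)"
  proof
    fix r
    have "A r = theta_weight (q ^ c * ?p ^ (1 + e)) (q ^ 3 * ?p ^ 2) r"
      unfolding A_def using q e by (intro theta_weight_bailey) auto
    moreover have "q ^ c * ?p ^ (1 + e) = q ^ (c + 2 + 2 * e)" "q ^ 3 * ?p ^ 2 = q ^ 7"
      by (intro pw, simp)+
    ultimately show "A r = theta_weight (q ^ (c + 2 + 2 * e)) (q ^ 7) r" by (simp only:)
  qed
  have A2: "?p ^ nat (r ^ 2 + int e * r) * A r = theta_weight (q ^ (c + 4 + 4 * e)) (q ^ 11) r" for r
  proof -
    have "?p ^ nat (r ^ 2 + int e * r) * A r
       = theta_weight (q ^ (c + 2 + 2 * e) * ?p ^ (1 + e)) (q ^ 7 * ?p ^ 2) r"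
      unfolding A using q e by (intro theta_weight_bailey) auto
    moreover have "q ^ (c + 2 + 2 * e) * ?p ^ (1 + e) = q ^ (c + 4 + 4 * e)" "q ^ 7 * ?p ^ 2 = q ^ 11"
      by (intro pw, simp)+
    ultimately show ?thesis by (simp only:)
  qed
  have quot: "q ^ a / q ^ b = q ^ (a - b)" if "b \<le> a" for a b
    using q that by (simp add: power_diff)
  have "(\<lambda>r. norm (A r)) summable_on UNIV"
    unfolding A
  proof (rule theta_weight_summable)
    show "norm (q ^ 7 / q ^ (c + 2 + 2 * e)) \<le> 1"
      using c e norm_le by (subst quot) auto
    show "norm (q ^ 7) < 1" using q by (simp add: norm_power power_less_one_iff)
  qed (rule norm_le | use q in simp)+
  from bailey_limit(2)[OF q2 e this]
  have "S = E * ((\<Sum>\<^sub>\<infinity>r. theta_weight (q ^ (c + 4 + 4 * e)) (q ^ 11) r) / qpoch_inf ?p ?p)"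
    unfolding S A2 by simp
  also have "(\<Sum>\<^sub>\<infinity>r. theta_weight (q ^ (c + 4 + 4 * e)) (q ^ 11) r)
      = qpoch_inf (q ^ (c + 4 + 4 * e)) (q ^ 11) * qpoch_inf (q ^ (7 - 4 * e - c)) (q ^ 11)
          * qpoch_inf (q ^ 11) (q ^ 11)"
  proof -
    have *: "q ^ 11 / q ^ (c + 4 + 4 * e) = q ^ (7 - 4 * e - c)"
      using c e by (subst quot) (auto simp: add.commute)
    show ?thesis
      by (rule jacobi_triple_product[OF q11, of "q ^ (c + 4 + 4 * e)", unfolded *])
         (rule norm_le | use q in simp)+
  qed
  also have "E * (x / qpoch_inf ?p ?p) = x / (qpoch_inf q (q ^ 2) * qpoch_inf (q ^ 4) (q ^ 4))" for x
  proof -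
    have "E * (x / qpoch_inf ?p ?p) = x * (E / qpoch_inf ?p ?p)" by simp
    thus ?thesis unfolding E_def euler_factor_over_qpoch_inf[OF q(1)] by simp
  qed
  finally have "S = ?rhs" .
  with \<open>(?F has_sum S) UNIV\<close> show ?thesis by simp
qed

lemma qpoch_0_base [simp]: "qpoch 0 0 n = 1" and qpoch_inf_0_base [simp]: "qpoch_inf 0 0 = 1"
  by (simp_all add: qpoch_def qpoch_inf_def)

text \<open>
  At \<open>q = 0\<close> only the term \<open>i = j = k = 0\<close> survives, because \<open>0\<^sup>0 = 1\<close>.
\<close>
lemma triple_sum_at_0:
  "((\<lambda>(i, j, k). (0::complex) ^ (i ^ 2 + 2 * j ^ 2 + 4 * k ^ 2 + 2 * i * k + 4 * j * k + l i j k) /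
      (qpoch (0 ^ 2) (0 ^ 2) i * qpoch (0 ^ 2) (0 ^ 2) j * qpoch (0 ^ 4) (0 ^ 4) k)) has_sum 1) UNIV"
  if "l 0 0 0 = 0" for l :: "nat \<Rightarrow> nat \<Rightarrow> nat \<Rightarrow> nat"
  by (rule has_sum_finite_neutralI[of "{(0, 0, 0)}"]) (use that in \<open>auto simp: power_0_left split: if_splits\<close>)

theorem theorem3p17:
  fixes q :: complex
  assumes "norm q < 1"
  shows
    "((\<lambda>(i::nat, j::nat, k::nat).
        q ^ (i^2 + 2*j^2 + 4*k^2 + 2*i*k + 4*j*k) /
          (qpoch (q^2) (q^2) i * qpoch (q^2) (q^2) j * qpoch (q^4) (q^4) k))
      has_sum
        (qpoch_inf_list [q^5, q^6, q^11] (q^11) /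
          (qpoch_inf q (q^2) * qpoch_inf (q^4) (q^4)))) UNIV
      \<and>
    ((\<lambda>(i::nat, j::nat, k::nat).
        q ^ (i^2 + 2*j^2 + 4*k^2 + 2*i*k + 4*j*k + 2*k) /
          (qpoch (q^2) (q^2) i * qpoch (q^2) (q^2) j * qpoch (q^4) (q^4) k))
      has_sum
        (qpoch_inf_list [q^4, q^7, q^11] (q^11) /
          (qpoch_inf q (q^2) * qpoch_inf (q^4) (q^4)))) UNIV
      \<and>
    ((\<lambda>(i::nat, j::nat, k::nat).
        q ^ (i^2 + 2*j^2 + 4*k^2 + 2*i*k + 4*j*k + 2*j + 4*k) /
          (qpoch (q^2) (q^2) i * qpoch (q^2) (q^2) j * qpoch (q^4) (q^4) k))
      has_sum
        (qpoch_inf_list [q^2, q^9, q^11] (q^11) /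
          (qpoch_inf q (q^2) * qpoch_inf (q^4) (q^4)))) UNIV
      \<and>
    ((\<lambda>(i::nat, j::nat, k::nat).
        q ^ (i^2 + 2*j^2 + 4*k^2 + 2*i*k + 4*j*k + 2*i + 2*j + 4*k) /
          (qpoch (q^2) (q^2) i * qpoch (q^2) (q^2) j * qpoch (q^4) (q^4) k))
      has_sum
        (qpoch_inf_list [q, q^10, q^11] (q^11) /
          (qpoch_inf q (q^2) * qpoch_inf (q^4) (q^4)))) UNIV"
proof (cases "q = 0")
  case True
  show ?thesis
    using triple_sum_at_0[of "\<lambda>_ _ _. 0"] triple_sum_at_0[of "\<lambda>_ _ k. 2 * k"]
      triple_sum_at_0[of "\<lambda>_ j k. 2 * j + 4 * k"] triple_sum_at_0[of "\<lambda>i j k. 2 * i + 2 * j + 4 * k"]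
    by (simp add: True qpoch_inf_list_def add.assoc)
next
  case False
  let ?B = "\<lambda>e c. \<lambda>k. bailey_sum (q ^ 2) (int k) (int k + int e) (theta_weight (q ^ c) (q ^ 3))"
  note triple = triple_sum_of_bailey_pair[OF assms False]
  have pair1: "q ^ (2 * 0 * k) / (qpoch (q ^ 4) (q ^ 4) k * qpoch (- q) (q ^ 2) (k + 0)) = ?B 0 2 k" for k
    using bailey_pair_diagonal_2[OF assms False, of k] by simp
  have pair2: "q ^ (2 * 1 * k) / (qpoch (q ^ 4) (q ^ 4) k * qpoch (- q) (q ^ 2) (k + 0)) = ?B 0 3 k" for k
    using bailey_pair_diagonal_2[OF assms False, of k] diagonal_3_eq_diagonal_2[OF assms False, of k] by simp
  have pair3: "q ^ (2 * 0 * k) / (qpoch (q ^ 4) (q ^ 4) k * qpoch (- q) (q ^ 2) (k + 0)) = ?B 1 1 k" for k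
    using bailey_pair_diagonal_2[OF assms False, of k] off_diagonal_1_eq_diagonal_2[OF assms False, of k] by simp
  have pair4: "q ^ (2 * 0 * k) / (qpoch (q ^ 4) (q ^ 4) k * qpoch (- q) (q ^ 2) (k + 1)) = ?B 1 2 k" for k
    using bailey_pair_off_diagonal_2[OF assms False, of k] by simp
  show ?thesis
    using triple[OF _ _ pair1] triple[OF _ _ pair2] triple[OF _ _ pair3] triple[OF _ _ pair4]
    by (simp add: qpoch_inf_list_def ac_simps)
qed

end
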